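(* Let $\Sigma^+=\mathbb{R}^N\times(0,+\infty)$ and $\Sigma=\mathbb{R}^N\times\mathbb{R}$. Self-similar solutions in $\Sigma^+$ to $$\partial_t u=\sum_{i=1}^N\partial_i\big(|\partial_i u|^{p_i-2}\partial_i u\big)\qquad(\mathrm{A})$$ correspond, via the map $\Phi$, to stationary solutions to the anisotropic Fokker-Planck equation $$\partial_t w=\sum_{i=1}^N\partial_i\big[|\partial_i w|^{p_i-2}\partial_i w+\alpha_i x_i w\big]\quad\text{in }\Sigma,\qquad(\mathrm{FP})$$ and vice-versa. That is: if $u$ is a self-similar solution to (A) in $\Sigma^+$, then $w=\Phi(u)$ is a stationary (i.e. time-independent) solution to (FP); and if $w$ is a stationary solution to (FP), then $u=\Phi^{-1}(w)$ is a self-similar solution to (A) in $\Sigma^+$.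
   Context: $N\in\mathbb{N}$, $N>1$. The exponents $p_1,\dots,p_N$ are fixed, $\bar p=N\big(\sum_{i=1}^N 1/p_i\big)^{-1}$, $\bar p<N$, $\bar p^*=N\bar p/(N-\bar p)$, and $2<p_1\le p_2\le\dots\le p_N<\bar p^*$. Moreover $$\lambda=N(\bar p-2)+\bar p,\qquad \alpha=\frac N\lambda,\qquad \alpha_i=\frac{N(\bar p-p_i)+\bar p}{\lambda p_i}.$$ The map $\Phi$ and its inverse are $$\Phi(u)(x,t)=e^{\alpha t}u\big((e^{\alpha_i t}x_i)_i,e^t\big),\quad (x,t)\in\Sigma;\qquad \Phi^{-1}(w)(y,s)=s^{-\alpha}w\big((s^{-\alpha_i}y_i)_i,\log s\big),\quad (y,s)\in\Sigma^+.$$ For $\rho>0$, $\mathcal{T}_\rho u(x,t)=\rho^{\alpha\bar p}u\big((\rho^{\alpha_i\bar p}x_i)_i,\rho^{\bar p}t\big)$. A solution $u$ to (A) in $\Sigma^+$ is self-similar if $\mathcal{T}_\rho u=u$ for all $\rho>0$. Solutions are local weak solutions. Let $O\subset\mathbb{R}^N$ be open and $I\subset\mathbb{R}$ an open interval. A function $u\in C^0(I;L^2_{loc}(O))$ with $u\in L^1_{loc}(I;W^{1,1}_{loc}(O))$ and $\partial_i u\in L^{p_i}_{loc}(I;L^{p_i}_{loc}(O))$ for all $i$ is a local weak solution to (A) in $O\times I$ if for all $t_1<t_2$ in $I$, all compact $K\subset O$ and all smooth $\varphi$ on $O\times I$ with $\varphi(\cdot,t)$ supported in $K$ for every $t$,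 $$\int_K u\varphi\,dx\Big|_{t_1}^{t_2}+\int_{t_1}^{t_2}\!\!\int_K\Big(-u\,\partial_t\varphi+\sum_{i=1}^N|\partial_i u|^{p_i-2}\partial_i u\,\partial_i\varphi\Big)dx\,dt=0.$$ Local weak solutions to (FP) are defined in the same way, with $|\partial_i u|^{p_i-2}\partial_i u$ replaced by $|\partial_i w|^{p_i-2}\partial_i w+\alpha_i x_i w$. *)

theory Defs
  imports "HOL-Analysis.Analysis"
begin

text \<open>
  Space is \<^typ>\<open>real ^ 'n\<close>, so $N$ is \<^term>\<open>CARD('n)\<close>; functions of $(x,t)$ have domain
  \<^typ>\<open>(real ^ 'n) \<times> real\<close>. Elements of function spaces are represented by actual functions.
  As members of $C^0(I; L^2_{loc})$ two of them are equal iff, for every single time $t$,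
  they agree for almost every $x$; self-similarity and stationarity below are understood in
  this sense.
\<close>

section \<open>Exponents\<close>

definition pbar :: "('n::finite \<Rightarrow> real) \<Rightarrow> real" where
  "pbar p = real CARD('n) / (\<Sum>i\<in>UNIV. 1 / p i)"

definition pbar_star :: "('n::finite \<Rightarrow> real) \<Rightarrow> real" where
  "pbar_star p = real CARD('n) * pbar p / (real CARD('n) - pbar p)"

definition lam :: "('n::finite \<Rightarrow> real) \<Rightarrow> real" where
  "lam p = real CARD('n) * (pbar p - 2) + pbar p"

definition alpha :: "('n::finite \<Rightarrow> real) \<Rightarrow> real" where
  "alpha p = real CARD('n) / lam p"

definition alpha_i :: "('n::finite \<Rightarrow> real) \<Rightarrow> 'n \<Rightarrow> real" where
  "alpha_i p i = (real CARD('n) * (pbar p - p i) + pbar p) / (lam p * p i)"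

section \<open>Smooth functions\<close>

text \<open>Meant for open \<open>S\<close>: \<open>Ck_on k S f\<close> says that \<open>f\<close> is of class $C^k$ on \<open>S\<close>.\<close>

fun Ck_on :: "nat \<Rightarrow> 'a::euclidean_space set \<Rightarrow> ('a \<Rightarrow> real) \<Rightarrow> bool" where
  "Ck_on 0 S f \<longleftrightarrow> continuous_on S f"
| "Ck_on (Suc k) S f \<longleftrightarrow> (\<forall>x\<in>S. f differentiable (at x)) \<and>
     (\<forall>v. Ck_on k S (\<lambda>x. frechet_derivative f (at x) v))"

definition smooth_on :: "'a::euclidean_space set \<Rightarrow> ('a \<Rightarrow> real) \<Rightarrow> bool" where
  "smooth_on S f \<longleftrightarrow> (\<forall>k. Ck_on k S f)"

section \<open>Local function spaces\<close>

definition Lq_loc :: "real \<Rightarrow> 'a::euclidean_space set \<Rightarrow> ('a \<Rightarrow> real) \<Rightarrow> bool" where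
  "Lq_loc q U f \<longleftrightarrow> f \<in> borel_measurable (lebesgue_on U) \<and>
     (\<forall>K. compact K \<and> K \<subseteq> U \<longrightarrow> set_integrable lebesgue K (\<lambda>x. \<bar>f x\<bar> powr q))"

text \<open>\<open>g\<close> is the \<open>i\<close>-th weak partial derivative of \<open>f\<close> in \<open>U\<close>.\<close>

definition weak_partial ::
    "(real ^ 'n::finite) set \<Rightarrow> (real ^ 'n \<Rightarrow> real) \<Rightarrow> 'n \<Rightarrow> (real ^ 'n \<Rightarrow> real) \<Rightarrow> bool" where
  "weak_partial U f i g \<longleftrightarrow>
     (\<forall>K \<psi>. compact K \<and> K \<subseteq> U \<and> smooth_on U \<psi> \<and> (\<forall>x\<in>U - K. \<psi> x = 0) \<longrightarrow>
       (LINT x:K|lebesgue. f x * frechet_derivative \<psi> (at x) (axis i 1)) =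
       - (LINT x:K|lebesgue. g x * \<psi> x))"

text \<open>$f \in W^{1,1}_{loc}(U)$ with weak gradient \<open>G\<close>.\<close>

definition W11_loc ::
    "(real ^ 'n::finite) set \<Rightarrow> (real ^ 'n \<Rightarrow> real) \<Rightarrow> ('n \<Rightarrow> real ^ 'n \<Rightarrow> real) \<Rightarrow> bool" where
  "W11_loc U f G \<longleftrightarrow> Lq_loc 1 U f \<and> (\<forall>i. Lq_loc 1 U (G i) \<and> weak_partial U f i (G i))"

text \<open>$u \in C^0(I; L^2_{loc}(U))$.\<close>

definition C0_L2_loc ::
    "real set \<Rightarrow> 'a::euclidean_space set \<Rightarrow> ('a \<times> real \<Rightarrow> real) \<Rightarrow> bool" where
  "C0_L2_loc I U u \<longleftrightarrow> (\<forall>t\<in>I. Lq_loc 2 U (\<lambda>x. u (x, t))) \<and>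
     (\<forall>K. compact K \<and> K \<subseteq> U \<longrightarrow> (\<forall>t\<^sub>0\<in>I.
       ((\<lambda>t. LINT x:K|lebesgue. (u (x, t) - u (x, t\<^sub>0))\<^sup>2) \<longlongrightarrow> 0) (at t\<^sub>0 within I)))"

text \<open>$f \in L^q_{loc}(I; L^q_{loc}(U))$. The inner integral in the last clause is
  $\|f(\cdot,t)\|_{L^q(K)}^q$; joint measurability makes $t \mapsto f(\cdot,t)$ strongly measurable.\<close>

definition Lq_loc_Lq_loc ::
    "real \<Rightarrow> real set \<Rightarrow> 'a::euclidean_space set \<Rightarrow> ('a \<times> real \<Rightarrow> real) \<Rightarrow> bool" where
  "Lq_loc_Lq_loc q I U f \<longleftrightarrow> f \<in> borel_measurable (lebesgue_on (U \<times> I)) \<and>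
     (AE t in lebesgue_on I. Lq_loc q U (\<lambda>x. f (x, t))) \<and>
     (\<forall>J K. compact J \<and> J \<subseteq> I \<and> compact K \<and> K \<subseteq> U \<longrightarrow>
       set_integrable lebesgue J (\<lambda>t. LINT x:K|lebesgue. \<bar>f (x, t)\<bar> powr q))"

text \<open>$u \in L^1_{loc}(I; W^{1,1}_{loc}(U))$ with weak spatial gradient \<open>G\<close>.\<close>

definition L1_loc_W11_loc ::
    "real set \<Rightarrow> (real ^ 'n::finite) set \<Rightarrow> ((real ^ 'n) \<times> real \<Rightarrow> real) \<Rightarrow>
      ('n \<Rightarrow> (real ^ 'n) \<times> real \<Rightarrow> real) \<Rightarrow> bool" where
  "L1_loc_W11_loc I U u G \<longleftrightarrow>
     (AE t in lebesgue_on I. W11_loc U (\<lambda>x. u (x, t)) (\<lambda>i x. G i (x, t))) \<and>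
     Lq_loc_Lq_loc 1 I U u \<and> (\<forall>i. Lq_loc_Lq_loc 1 I U (G i))"

section \<open>Local weak solutions\<close>

text \<open>
  Local weak solutions in \<open>U \<times> I\<close> of
  $\partial_t u = \sum_i \partial_i [A_i(x, u, \partial_i u)]$,
  where \<open>p i\<close> is the integrability exponent of $\partial_i u$. The weak gradient \<open>G\<close> is
  determined almost everywhere by \<open>u\<close>.
\<close>

definition local_weak_solution ::
    "('n::finite \<Rightarrow> real) \<Rightarrow> ('n \<Rightarrow> real ^ 'n \<Rightarrow> real \<Rightarrow> real \<Rightarrow> real) \<Rightarrow>
      (real ^ 'n) set \<Rightarrow> real set \<Rightarrow> ((real ^ 'n) \<times> real \<Rightarrow> real) \<Rightarrow> bool" where
  "local_weak_solution p A U I u \<longleftrightarrow>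
     open U \<and> open I \<and> is_interval I \<and> C0_L2_loc I U u \<and>
     (\<exists>G. L1_loc_W11_loc I U u G \<and> (\<forall>i. Lq_loc_Lq_loc (p i) I U (G i)) \<and>
       (\<forall>t\<^sub>1\<in>I. \<forall>t\<^sub>2\<in>I. \<forall>K \<phi>.
         t\<^sub>1 < t\<^sub>2 \<and> compact K \<and> K \<subseteq> U \<and> smooth_on (U \<times> I) \<phi> \<and>
         (\<forall>t\<in>I. \<forall>x\<in>U - K. \<phi> (x, t) = 0) \<longrightarrow>
         (LINT x:K|lebesgue. u (x, t\<^sub>2) * \<phi> (x, t\<^sub>2)) - (LINT x:K|lebesgue. u (x, t\<^sub>1) * \<phi> (x, t\<^sub>1)) +
         (LINT t:{t\<^sub>1..t\<^sub>2}|lebesgue. LINT x:K|lebesgue.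
            - u (x, t) * frechet_derivative \<phi> (at (x, t)) (0, 1) +
            (\<Sum>i\<in>UNIV. A i x (u (x, t)) (G i (x, t)) *
               frechet_derivative \<phi> (at (x, t)) (axis i 1, 0))) = 0))"

definition flux_A :: "('n::finite \<Rightarrow> real) \<Rightarrow> 'n \<Rightarrow> real ^ 'n \<Rightarrow> real \<Rightarrow> real \<Rightarrow> real" where
  "flux_A p i x v \<xi> = \<bar>\<xi>\<bar> powr (p i - 2) * \<xi>"

definition flux_FP :: "('n::finite \<Rightarrow> real) \<Rightarrow> 'n \<Rightarrow> real ^ 'n \<Rightarrow> real \<Rightarrow> real \<Rightarrow> real" where
  "flux_FP p i x v \<xi> = \<bar>\<xi>\<bar> powr (p i - 2) * \<xi> + alpha_i p i * x $ i * v"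

text \<open>
  Equation (A), $\partial_t u = \sum_i \partial_i(|\partial_i u|^{p_i-2}\partial_i u)$, is posed on
  $\Sigma^+ = R^N \times (0,+\infty)$; the anisotropic Fokker-Planck equation (FP),
  $\partial_t w = \sum_i \partial_i[|\partial_i w|^{p_i-2}\partial_i w + \alpha_i x_i w]$, is posed on
  $\Sigma = R^N \times R$.
\<close>

definition solution_A :: "('n::finite \<Rightarrow> real) \<Rightarrow> ((real ^ 'n) \<times> real \<Rightarrow> real) \<Rightarrow> bool" where
  "solution_A p u \<longleftrightarrow> local_weak_solution p (flux_A p) UNIV {0<..} u"

definition solution_FP :: "('n::finite \<Rightarrow> real) \<Rightarrow> ((real ^ 'n) \<times> real \<Rightarrow> real) \<Rightarrow> bool" where
  "solution_FP p w \<longleftrightarrow> local_weak_solution p (flux_FP p) UNIV UNIV w"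

section \<open>Scaling, self-similar and stationary solutions, the map \<open>\<Phi>\<close>\<close>

definition scaling ::
    "('n::finite \<Rightarrow> real) \<Rightarrow> real \<Rightarrow> ((real ^ 'n) \<times> real \<Rightarrow> real) \<Rightarrow> (real ^ 'n) \<times> real \<Rightarrow> real" where
  "scaling p \<rho> u = (\<lambda>(x, t).
     \<rho> powr (alpha p * pbar p) *
       u ((\<chi> i. \<rho> powr (alpha_i p i * pbar p) * x $ i), \<rho> powr pbar p * t))"

definition self_similar_solution_A ::
    "('n::finite \<Rightarrow> real) \<Rightarrow> ((real ^ 'n) \<times> real \<Rightarrow> real) \<Rightarrow> bool" where
  "self_similar_solution_A p u \<longleftrightarrow> solution_A p u \<and>
     (\<forall>\<rho>>0. \<forall>t>0. AE x in lebesgue. scaling p \<rho> u (x, t) = u (x, t))"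

definition stationary_solution_FP ::
    "('n::finite \<Rightarrow> real) \<Rightarrow> ((real ^ 'n) \<times> real \<Rightarrow> real) \<Rightarrow> bool" where
  "stationary_solution_FP p w \<longleftrightarrow> solution_FP p w \<and>
     (\<forall>s t. AE x in lebesgue. w (x, s) = w (x, t))"

definition Phi ::
    "('n::finite \<Rightarrow> real) \<Rightarrow> ((real ^ 'n) \<times> real \<Rightarrow> real) \<Rightarrow> (real ^ 'n) \<times> real \<Rightarrow> real" where
  "Phi p u = (\<lambda>(x, t).
     exp (alpha p * t) * u ((\<chi> i. exp (alpha_i p i * t) * x $ i), exp t))"

text \<open>The inverse of \<open>\<Phi>\<close>; only its values for \<open>s > 0\<close> are meaningful.\<close>

definition Phi_inv ::
    "('n::finite \<Rightarrow> real) \<Rightarrow> ((real ^ 'n) \<times> real \<Rightarrow> real) \<Rightarrow> (real ^ 'n) \<times> real \<Rightarrow> real" where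
  "Phi_inv p w = (\<lambda>(y, s).
     s powr (- alpha p) * w ((\<chi> i. s powr (- alpha_i p i) * y $ i), ln s))"

end

theory Submission
  imports Defs
begin

text \<open>
  Formally the statement is a change of variables. Put \<open>w(x, t) = exp (\<alpha> t) u(y, s)\<close> with
  \<open>y\<^sub>i = exp (\<alpha>\<^sub>i t) x\<^sub>i\<close> and \<open>s = exp t\<close>. Differentiating in \<open>t\<close> produces, besides
  a multiple of \<open>\<partial>\<^sub>s u\<close>, the terms \<open>\<alpha> w + \<Sum>\<^sub>i \<alpha>\<^sub>i x\<^sub>i \<partial>\<^sub>i w\<close>, and because
  \<open>\<alpha> = \<Sum>\<^sub>i \<alpha>\<^sub>i\<close> (\<open>sum_alpha_i\<close>) their sum is \<open>\<Sum>\<^sub>i \<partial>\<^sub>i (\<alpha>\<^sub>i x\<^sub>i w)\<close>, the drift in (FP). The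
  relation \<open>(\<alpha> + \<alpha>\<^sub>i) (p\<^sub>i - 1) = \<alpha> + 1 - \<alpha>\<^sub>i\<close> (\<open>alpha_balance\<close>) makes the powers of
  \<open>exp t\<close> in all diffusion terms agree with that of the time derivative. So \<open>u\<close> solves (A) exactly
  when \<open>w\<close> solves (FP). Self-similarity of \<open>u\<close> with \<open>\<rho> = exp (t / pbar p)\<close>,
  read at time 1, says that \<open>w(x, t) = u(x, 1)\<close> for almost every \<open>x\<close>, which is stationarity; the
  converse is a similar substitution.

  For local weak solutions the computation is carried out on the side of the test functions, in
  the theorem \<open>local_weak_solution_pullback\<close>. It is stated for a general substitution
  \<open>(y, s) = (dil (E t) x, \<tau> t)\<close>, so that \<open>\<Phi>\<close> and its inverse are two instances. Four points need
  an argument beyond the chain rule. A test function transported by the inverse substitution has a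
  support that moves with time, whereas its slices at all times are to be supported in one compact
  set; it is multiplied by a smooth cutoff in time (\<open>transported_test_function\<close>). Continuity in
  time with values in \<open>L\<^sup>2\<close> requires that dilations act continuously on \<open>L\<^sup>2\<close>, which follows from
  approximation by continuous functions (\<open>dil_continuous_L2\<close>). Joint Lebesgue measurability
  survives the substitution since the inverse substitution is differentiable
  (\<open>measurable_pullback\<close>). Finally, the integrals over moving regions in the local integrability
  conditions are measurable in time by Tonelli's theorem and are bounded by integrals over a fixed
  compact set (\<open>Lq_loc_Lq_loc_pullback\<close>).
\<close>

section \<open>Calculus of smooth functions\<close>

lemma Ck_on_cong:
  assumes "open S" "\<And>x. x \<in> S \<Longrightarrow> f x = g x" "Ck_on k S f"
  shows "Ck_on k S g"
  using assms(2,3)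
proof (induction k arbitrary: f g)
  case 0
  then show ?case by (simp cong: continuous_on_cong)
next
  case (Suc k)
  have der: "(g has_derivative frechet_derivative f (at x)) (at x)" if "x \<in> S" for x
  proof (rule has_derivative_transform_within_open[OF _ assms(1) that])
    show "(f has_derivative frechet_derivative f (at x)) (at x)"
      using Suc.prems(2) that by (simp add: frechet_derivative_works[symmetric])
  qed (use Suc.prems(1) in auto)
  have "Ck_on k S (\<lambda>x. frechet_derivative g (at x) v)" for v
  proof (rule Suc.IH)
    show "Ck_on k S (\<lambda>x. frechet_derivative f (at x) v)"
      using Suc.prems(2) by simp
    show "frechet_derivative f (at x) v = frechet_derivative g (at x) v" if "x \<in> S" for x
      using frechet_derivative_at[OF der[OF that]] by simp
  qed
  moreover have "g differentiable (at x)" if "x \<in> S" for x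
    using der[OF that] by (auto simp: differentiable_def)
  ultimately show ?case by simp
qed

lemma Ck_on_SucI:
  assumes "open S" "\<And>x. x \<in> S \<Longrightarrow> (f has_derivative f' x) (at x)"
    and "\<And>v. Ck_on k S (\<lambda>x. f' x v)"
  shows "Ck_on (Suc k) S f"
proof -
  have "Ck_on k S (\<lambda>x. frechet_derivative f (at x) v)" for v
    by (rule Ck_on_cong[OF assms(1) _ assms(3)[of v]])
       (use frechet_derivative_at[OF assms(2)] in auto)
  moreover have "f differentiable (at x)" if "x \<in> S" for x
    using assms(2)[OF that] by (auto simp: differentiable_def)
  ultimately show ?thesis by simp
qed

lemma Ck_on_Suc_has_derivative:
  assumes "Ck_on (Suc k) S f" "x \<in> S"
  shows "(f has_derivative frechet_derivative f (at x)) (at x)"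
  using assms by (simp add: frechet_derivative_works[symmetric])

lemma Ck_on_SucD: "Ck_on (Suc k) S f \<Longrightarrow> Ck_on k S f"
proof (induction k arbitrary: f)
  case 0
  then have "f differentiable_on S"
    using differentiable_at_imp_differentiable_on by auto
  then show ?case by (simp add: differentiable_imp_continuous_on)
next
  case (Suc k)
  have "Ck_on k S (\<lambda>x. frechet_derivative f (at x) v)" for v
    by (rule Suc.IH) (use Suc.prems in \<open>simp only: Ck_on.simps(2)[of "Suc k"]\<close>)
  moreover have "\<forall>x\<in>S. f differentiable (at x)"
    using Suc.prems by (simp only: Ck_on.simps(2)[of "Suc k"]) blast
  ultimately show ?case by (simp only: Ck_on.simps(2)) simp
qed

lemma Ck_on_const: "open S \<Longrightarrow> Ck_on k S (\<lambda>x. c)"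
proof (induction k arbitrary: c)
  case (Suc k)
  show ?case
    by (rule Ck_on_SucI[OF Suc.prems, where f'="\<lambda>x v. 0"]) (use Suc in auto)
qed simp

lemma Ck_on_bounded_linear:
  assumes "open S" "bounded_linear f" shows "Ck_on k S f"
proof (cases k)
  case 0
  then show ?thesis
    using assms(2) by (simp add: linear_continuous_on)
next
  case (Suc m)
  have "Ck_on (Suc m) S f"
    by (rule Ck_on_SucI[where f'="\<lambda>x. f"])
       (use assms in \<open>auto intro: bounded_linear_imp_has_derivative Ck_on_const\<close>)
  with Suc show ?thesis by simp
qed

lemma Ck_on_add:
  assumes "open S" "Ck_on k S f" "Ck_on k S g" shows "Ck_on k S (\<lambda>x. f x + g x)"
  using assms(2,3)
proof (induction k arbitrary: f g)
  case 0
  then show ?case by (auto intro: continuous_on_add)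
next
  case (Suc k)
  show ?case
  proof (rule Ck_on_SucI[OF assms(1)])
    show "((\<lambda>x. f x + g x) has_derivative
        (\<lambda>v. frechet_derivative f (at x) v + frechet_derivative g (at x) v)) (at x)" if "x \<in> S" for x
      using that Suc.prems by (intro has_derivative_add Ck_on_Suc_has_derivative)
  qed (use Suc in auto)
qed

lemma Ck_on_sum:
  assumes "open S" "\<And>i. i \<in> A \<Longrightarrow> Ck_on k S (f i)" shows "Ck_on k S (\<lambda>x. \<Sum>i\<in>A. f i x)"
  using assms(2)
proof (induction A rule: infinite_finite_induct)
  case (insert a A)
  then show ?case by (simp add: Ck_on_add[OF assms(1)])
qed (simp_all add: Ck_on_const[OF assms(1)])

lemma Ck_on_mult:
  assumes "open S" "Ck_on k S f" "Ck_on k S g" shows "Ck_on k S (\<lambda>x. f x * g x)"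
  using assms(2,3)
proof (induction k arbitrary: f g)
  case 0
  then show ?case by (auto intro: continuous_on_mult)
next
  case (Suc k)
  show ?case
  proof (rule Ck_on_SucI[OF assms(1)])
    show "((\<lambda>x. f x * g x) has_derivative
        (\<lambda>v. f x * frechet_derivative g (at x) v + frechet_derivative f (at x) v * g x)) (at x)"
      if "x \<in> S" for x
      using that Suc.prems by (intro has_derivative_mult Ck_on_Suc_has_derivative)
    show "Ck_on k S (\<lambda>x. f x * frechet_derivative g (at x) v + frechet_derivative f (at x) v * g x)" for v
      using Suc.prems
      by (intro Ck_on_add[OF assms(1)] Suc.IH Ck_on_SucD[OF Suc.prems(1)] Ck_on_SucD[OF Suc.prems(2)]) auto
  qed
qed

text \<open>By the chain rule the partial derivatives of \<open>f \<circ> g\<close> are sums of products of partial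
  derivatives of \<open>f\<close>, composed with \<open>g\<close>, and of components of \<open>g\<close>; both factors have one
  derivative less to lose.\<close>

lemma Ck_on_compose:
  fixes f :: "'b::euclidean_space \<Rightarrow> real" and g :: "'a::euclidean_space \<Rightarrow> 'b"
  assumes S: "open S" and T: "open T" and gT: "g ` S \<subseteq> T"
    and "Ck_on k T f" "\<And>b. b \<in> Basis \<Longrightarrow> Ck_on k S (\<lambda>x. g x \<bullet> b)"
  shows "Ck_on k S (\<lambda>x. f (g x))"
  using assms(4,5)
proof (induction k arbitrary: f)
  case 0
  then have "continuous_on S g"
    by (subst continuous_on_componentwise) simp
  moreover have "continuous_on T f" using 0(1) by simp
  ultimately show ?case
    using continuous_on_compose2[of T f S g] gT by simp
next
  case (Suc k)
  let ?g' = "\<lambda>x v. \<Sum>b\<in>Basis. frechet_derivative (\<lambda>x. g x \<bullet> b) (at x) v *\<^sub>R b"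
  have g': "(g has_derivative ?g' x) (at x)" if "x \<in> S" for x
  proof (subst has_derivative_componentwise_within, intro ballI)
    fix b :: 'b assume b: "b \<in> Basis"
    show "((\<lambda>x. g x \<bullet> b) has_derivative (\<lambda>v. ?g' x v \<bullet> b)) (at x)"
      using Ck_on_Suc_has_derivative[OF Suc.prems(2)[OF b] that] b
      by (simp add: inner_sum_left inner_Basis if_distrib cong: if_cong)
  qed
  show ?case
  proof (rule Ck_on_SucI[OF S, where f' = "\<lambda>x v. \<Sum>b\<in>Basis.
        frechet_derivative (\<lambda>x. g x \<bullet> b) (at x) v * frechet_derivative f (at (g x)) b"])
    fix x assume x: "x \<in> S"
    have f': "(f has_derivative frechet_derivative f (at (g x))) (at (g x))"
      using Suc.prems(1) x gT by (intro Ck_on_Suc_has_derivative) auto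
    from has_derivative_compose[OF g'[OF x] f']
    show "((\<lambda>x. f (g x)) has_derivative (\<lambda>v. \<Sum>b\<in>Basis.
        frechet_derivative (\<lambda>x. g x \<bullet> b) (at x) v * frechet_derivative f (at (g x)) b)) (at x)"
      by (simp add: linear_sum[OF has_derivative_linear[OF f']]
          linear_scale[OF has_derivative_linear[OF f']])
  next
    fix v
    show "Ck_on k S (\<lambda>x. \<Sum>b\<in>Basis.
        frechet_derivative (\<lambda>x. g x \<bullet> b) (at x) v * frechet_derivative f (at (g x)) b)"
    proof (intro Ck_on_sum[OF S] Ck_on_mult[OF S])
      fix b :: 'b assume b: "b \<in> Basis"
      show "Ck_on k S (\<lambda>x. frechet_derivative (\<lambda>x. g x \<bullet> b) (at x) v)"
        using Suc.prems(2)[OF b] by simp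
      show "Ck_on k S (\<lambda>x. frechet_derivative f (at (g x)) b)"
      proof (rule Suc.IH)
        show "Ck_on k T (\<lambda>y. frechet_derivative f (at y) b)"
          using Suc.prems(1) by simp
        show "Ck_on k S (\<lambda>x. g x \<bullet> c)" if "c \<in> Basis" for c
          by (rule Ck_on_SucD[OF Suc.prems(2)[OF that]])
      qed
    qed
  qed
qed

lemma smooth_on_cong:
  assumes "open S" "\<And>x. x \<in> S \<Longrightarrow> f x = g x" "smooth_on S f"
  shows "smooth_on S g"
  using assms(3) Ck_on_cong[of S f g, OF assms(1,2)] unfolding smooth_on_def by blast

lemma smooth_on_const: "open S \<Longrightarrow> smooth_on S (\<lambda>x. c)"
  by (simp add: smooth_on_def Ck_on_const)

lemma smooth_on_bounded_linear: "open S \<Longrightarrow> bounded_linear f \<Longrightarrow> smooth_on S f"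
  by (simp add: smooth_on_def Ck_on_bounded_linear)

lemma smooth_on_add: "open S \<Longrightarrow> smooth_on S f \<Longrightarrow> smooth_on S g \<Longrightarrow> smooth_on S (\<lambda>x. f x + g x)"
  by (simp add: smooth_on_def Ck_on_add)

lemma smooth_on_mult: "open S \<Longrightarrow> smooth_on S f \<Longrightarrow> smooth_on S g \<Longrightarrow> smooth_on S (\<lambda>x. f x * g x)"
  by (simp add: smooth_on_def Ck_on_mult)

lemma smooth_on_compose:
  assumes "open S" "open T" "g ` S \<subseteq> T" "smooth_on T f"
    and "\<And>b. b \<in> Basis \<Longrightarrow> smooth_on S (\<lambda>x. g x \<bullet> b)"
  shows "smooth_on S (\<lambda>x. f (g x))"
  using assms by (simp add: smooth_on_def Ck_on_compose[OF assms(1-3)])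

lemma smooth_on_compose_real:
  fixes f :: "real \<Rightarrow> real"
  assumes "open S" "open T" "g ` S \<subseteq> T" "smooth_on T f" "smooth_on S g"
  shows "smooth_on S (\<lambda>x. f (g x))"
  using smooth_on_compose[OF assms(1-4)] assms(5) by simp

lemma smooth_on_imp_has_derivative:
  assumes "smooth_on S f" "x \<in> S"
  shows "(f has_derivative frechet_derivative f (at x)) (at x)"
  using assms Ck_on_Suc_has_derivative[of 0] unfolding smooth_on_def by blast

text \<open>Smoothness of the elementary functions comes from families that are closed under
  differentiation up to linear combinations with constant coefficients: the powers, the functions
  \<open>exp (a t)\<close>, and the functions \<open>flat m\<close>.\<close>

lemma Ck_on_Suc_real:
  fixes f :: "real \<Rightarrow> real"
  assumes "open S" "\<And>x. x \<in> S \<Longrightarrow> (f has_real_derivative f' x) (at x)" "Ck_on k S f'"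
  shows "Ck_on (Suc k) S f"
proof (rule Ck_on_SucI[OF assms(1), where f'="\<lambda>x v. f' x * v"])
  show "(f has_derivative (*) (f' x)) (at x)" if "x \<in> S" for x
    using assms(2)[OF that] by (simp add: has_field_derivative_def)
  show "Ck_on k S (\<lambda>x. f' x * v)" for v
    by (intro Ck_on_mult assms Ck_on_const)
qed

lemma smooth_on_powr: "smooth_on {0<..} (\<lambda>s::real. s powr a)"
proof -
  have "Ck_on k {0<..} (\<lambda>s::real. s powr a)" for k
  proof (induction k arbitrary: a)
    case 0
    then show ?case by (auto intro!: continuous_intros)
  next
    case (Suc k)
    show ?case
      by (rule Ck_on_Suc_real[where f'="\<lambda>s. a * s powr (a - 1)"])
         (auto intro!: Ck_on_mult Ck_on_const Suc has_real_derivative_powr)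
  qed
  then show ?thesis by (simp add: smooth_on_def)
qed

lemma smooth_on_ln: "smooth_on {0<..} (ln :: real \<Rightarrow> real)"
proof -
  have "Ck_on k {0<..} (ln :: real \<Rightarrow> real)" for k
  proof (cases k)
    case 0
    then show ?thesis by (auto intro!: continuous_intros)
  next
    case (Suc m)
    have "Ck_on (Suc m) {0<..} (ln :: real \<Rightarrow> real)"
    proof (rule Ck_on_Suc_real)
      show "Ck_on m {0<..} (\<lambda>s::real. s powr (-1))"
        using smooth_on_powr[of "-1"] unfolding smooth_on_def by blast
      show "(ln has_real_derivative s powr (-1)) (at s)" if "s \<in> {0<..}" for s :: real
        using DERIV_ln_divide[of s] that by (simp add: powr_minus_divide)
    qed simp
    with Suc show ?thesis by simp
  qed
  then show ?thesis by (simp add: smooth_on_def)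
qed

lemma smooth_on_exp: "smooth_on UNIV (\<lambda>t::real. exp (a * t))"
proof -
  have "Ck_on k UNIV (\<lambda>t::real. exp (a * t))" for k
  proof (induction k)
    case 0
    then show ?case by (auto intro!: continuous_intros)
  next
    case (Suc k)
    show ?case
      by (rule Ck_on_Suc_real[where f'="\<lambda>s. a * exp (a * s)"])
         (auto intro!: Ck_on_mult Ck_on_const Suc derivative_eq_intros)
  qed
  then show ?thesis by (simp add: smooth_on_def)
qed

section \<open>A smooth cutoff in time\<close>

text \<open>The standard smooth function that vanishes to infinite order at 0, with the powers of
  \<open>1 / t\<close> that its derivatives produce.\<close>

definition flat :: "nat \<Rightarrow> real \<Rightarrow> real" where
  "flat m t = (if t \<le> 0 then 0 else (1 / t) ^ m * exp (- (1 / t)))"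

lemma flat_has_derivative:
  "(flat m has_real_derivative (flat (m + 2) t - real m * flat (m + 1) t)) (at t)"
proof -
  consider "t < 0" | "t = 0" | "t > 0" by linarith
  then show ?thesis
  proof cases
    case 1
    have "((\<lambda>t. 0) has_real_derivative 0) (at t)" by simp
    then have "(flat m has_real_derivative 0) (at t)"
      by (rule has_field_derivative_transform_within_open[where S="{..<0}"])
         (use 1 in \<open>auto simp: flat_def\<close>)
    then show ?thesis using 1 by (simp add: flat_def)
  next
    case 3
    have "((\<lambda>t. (1 / t) ^ m * exp (- (1 / t))) has_real_derivative
        (flat (m + 2) t - real m * flat (m + 1) t)) (at t)"
      using 3 by (auto intro!: derivative_eq_intros simp: flat_def field_simps power2_eq_square)
         (cases m; simp add: field_simps)
    then show ?thesis
      by (rule has_field_derivative_transform_within_open[where S="{0<..}"])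
         (use 3 in \<open>auto simp: flat_def\<close>)
  next
    case 2
    have "((\<lambda>x. x ^ (m + 1) / exp x) \<longlongrightarrow> (0::real)) at_top"
      by (rule tendsto_power_div_exp_0)
    then have "((\<lambda>h. (1 / h) ^ (m + 1) / exp (1 / h)) \<longlongrightarrow> (0::real)) (at_right 0)"
      by (subst (asm) filterlim_at_top_to_right) (simp add: inverse_eq_divide)
    then have right: "((\<lambda>h. flat m h / h) \<longlongrightarrow> 0) (at_right 0)"
      by (rule Lim_transform_eventually)
         (auto simp: flat_def eventually_at_filter exp_minus field_simps)
    have left: "((\<lambda>h. flat m h / h) \<longlongrightarrow> 0) (at_left 0)"
      by (rule Lim_transform_eventually[where f="\<lambda>_. 0"])
         (auto simp: flat_def eventually_at_filter)
    have "((\<lambda>h. flat m h / h) \<longlongrightarrow> 0) (at 0)"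
      using left right by (simp add: filterlim_split_at)
    then show ?thesis
      using 2 by (simp add: DERIV_def flat_def)
  qed
qed

lemma smooth_on_flat: "smooth_on UNIV (flat m)"
proof -
  have "Ck_on k UNIV (flat m)" for k
  proof (induction k arbitrary: m)
    case 0
    have "isCont (flat m) t" for t
      using flat_has_derivative DERIV_isCont by blast
    then show ?case by (simp add: continuous_at_imp_continuous_on)
  next
    case (Suc k)
    show ?case
    proof (rule Ck_on_Suc_real)
      have "Ck_on k UNIV (\<lambda>t. flat (m + 2) t + (- real m) * flat (m + 1) t)"
        by (intro Ck_on_add Ck_on_mult Ck_on_const Suc open_UNIV)
      then show "Ck_on k UNIV (\<lambda>t. flat (m + 2) t - real m * flat (m + 1) t)" by simp
    qed (use flat_has_derivative in auto)
  qed
  then show ?thesis by (simp add: smooth_on_def)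
qed

lemma flat_pos_iff: "0 < flat m t \<longleftrightarrow> 0 < t"
  by (auto simp: flat_def)

lemma flat_nonneg: "0 \<le> flat m t"
  by (auto simp: flat_def)

lemma smooth_step:
  obtains h :: "real \<Rightarrow> real" where "smooth_on UNIV h"
    "\<And>t. t \<le> 0 \<Longrightarrow> h t = 0" "\<And>t. 1 \<le> t \<Longrightarrow> h t = 1"
proof
  \<comment> \<open>Of \<open>t\<close> and \<open>1 - t\<close> at least one is positive, so the normalizing denominator never vanishes.\<close>
  define d where "d = (\<lambda>t. flat 0 t + flat 0 (1 + (-1) * t))"
  have d: "d t > 0" for t
    using flat_pos_iff[of 0 t] flat_pos_iff[of 0 "1 - t"] flat_nonneg[of 0 t] flat_nonneg[of 0 "1 - t"]
    by (cases "t > 0") (auto simp: d_def simp del: flat_pos_iff intro: add_pos_nonneg add_nonneg_pos)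
  have id: "smooth_on UNIV (\<lambda>t::real. t)"
    by (simp add: smooth_on_bounded_linear)
  have "smooth_on UNIV d"
    unfolding d_def
    by (intro smooth_on_add smooth_on_flat smooth_on_compose_real[OF _ _ _ smooth_on_flat]
        smooth_on_const smooth_on_mult id) auto
  then have "smooth_on UNIV (\<lambda>t. d t powr (-1))"
    by (intro smooth_on_compose_real[OF _ _ _ smooth_on_powr]) (use d in auto)
  then show "smooth_on UNIV (\<lambda>t. flat 0 t * d t powr (-1))"
    by (intro smooth_on_mult smooth_on_flat) auto
  show "flat 0 t * d t powr (-1) = 0" if "t \<le> 0" for t
    using that by (simp add: flat_def)
  show "flat 0 t * d t powr (-1) = 1" if "1 \<le> t" for t
    using that d[of t] by (simp add: d_def powr_minus flat_def)
qed

lemma smooth_cutoff: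
  fixes a b c d :: real
  assumes "a < b" "b < c" "c < d"
  obtains \<eta> where "smooth_on UNIV \<eta>" "\<And>s. s \<notin> {a..d} \<Longrightarrow> \<eta> s = 0" "\<And>s. s \<in> {b..c} \<Longrightarrow> \<eta> s = 1"
proof -
  obtain h :: "real \<Rightarrow> real" where h: "smooth_on UNIV h"
    "\<And>t. t \<le> 0 \<Longrightarrow> h t = 0" "\<And>t. 1 \<le> t \<Longrightarrow> h t = 1"
    using smooth_step by blast
  let ?l = "\<lambda>s. 1 / (b - a) * (s + - a)" and ?r = "\<lambda>s. 1 / (d - c) * (d + (-1) * s)"
  have id: "smooth_on UNIV (\<lambda>t::real. t)"
    by (simp add: smooth_on_bounded_linear)
  have l: "?l s = (s - a) / (b - a)" and r: "?r s = (d - s) / (d - c)" for s by simp_all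
  have smooth: "smooth_on UNIV (\<lambda>s. h (?l s))" "smooth_on UNIV (\<lambda>s. h (?r s))"
    by (rule smooth_on_compose_real[OF open_UNIV open_UNIV subset_UNIV h(1)];
        intro smooth_on_mult smooth_on_add smooth_on_const id open_UNIV)+
  show ?thesis
  proof
    show "smooth_on UNIV (\<lambda>s. h (?l s) * h (?r s))"
      by (rule smooth_on_mult[OF open_UNIV smooth])
    show "h (?l s) * h (?r s) = 0" if "s \<notin> {a..d}" for s
    proof (cases "s < a")
      case True
      then have "?l s \<le> 0" unfolding l using assms by (intro divide_nonpos_pos) auto
      then show ?thesis using h(2) by simp
    next
      case False
      then have "?r s \<le> 0" unfolding r using assms that by (intro divide_nonpos_pos) auto
      then show ?thesis using h(2) by simp
    qed
    show "h (?l s) * h (?r s) = 1" if "s \<in> {b..c}" for s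
    proof -
      have "1 \<le> ?l s" "1 \<le> ?r s" unfolding l r using assms that by (auto simp: pos_le_divide_eq)
      then show ?thesis using h(3) by simp
    qed
  qed
qed

section \<open>Anisotropic dilations\<close>

definition dil :: "('n::finite \<Rightarrow> real) \<Rightarrow> real ^ 'n \<Rightarrow> real ^ 'n" where
  "dil e x = (\<chi> i. e i * x $ i)"

lemma dil_nth [simp]: "dil e x $ i = e i * x $ i"
  by (simp add: dil_def)

lemma dil_inverse [simp]:
  assumes "\<And>i. e i > 0"
  shows "dil (\<lambda>i. 1 / e i) (dil e x) = x" "dil e (dil (\<lambda>i. 1 / e i) x) = x"
  using assms by (auto simp: vec_eq_iff less_imp_neq[THEN not_sym])

lemma bounded_linear_dil: "bounded_linear (dil e)"
  by (rule linear_conv_bounded_linear[THEN iffD1], rule linearI)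
     (auto simp: vec_eq_iff algebra_simps)

lemma dil_axis: "dil e (axis i 1) = e i *\<^sub>R axis i 1"
  by (auto simp: vec_eq_iff axis_def)

lemma norm_dil_le:
  assumes "\<And>i. \<bar>e i\<bar> \<le> B"
  shows "norm (dil e x) \<le> B * norm x"
proof -
  have "0 \<le> B" using assms order_trans abs_ge_zero by blast
  have "norm (dil e x) \<le> norm (B *\<^sub>R x)"
    by (rule norm_le_componentwise_cart)
       (use assms \<open>0 \<le> B\<close> in \<open>auto simp: abs_mult intro!: mult_right_mono\<close>)
  then show ?thesis using \<open>0 \<le> B\<close> by simp
qed

lemma lebesgue_dil:
  fixes e :: "'n::finite \<Rightarrow> real"
  assumes e: "\<And>i. e i > 0"
  shows "lebesgue = density (distr lebesgue lebesgue (dil e)) (\<lambda>_. ennreal (\<Prod>i\<in>UNIV. e i))"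
    and measurable_dil: "dil e \<in> lebesgue \<rightarrow>\<^sub>M lebesgue"
proof -
  \<comment> \<open>The affine change of variables indexes the factors by basis vectors instead of coordinates.\<close>
  define c where "c = (\<lambda>j :: real ^ 'n. e (THE i. j = axis i 1))"
  have c_axis: "c (axis i 1) = e i" for i
    by (simp add: c_def axis_eq_axis)
  have basis: "(Basis :: (real ^ 'n) set) = range (\<lambda>i. axis i 1)"
    by (auto simp: Basis_vec_def)
  have inj: "inj (\<lambda>i. axis i (1 :: real) :: real ^ 'n)"
    by (auto simp: inj_on_def axis_eq_axis)
  have c: "c j \<noteq> 0" if j: "j \<in> Basis" for j
  proof -
    obtain i where "j = axis i 1" using j by (auto simp: basis)
    then show ?thesis using e[of i] by (simp add: c_axis)
  qed
  have T: "(\<lambda>x. 0 + (\<Sum>j\<in>Basis. (c j * (x \<bullet> j)) *\<^sub>R j)) = dil e"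
  proof
    fix x :: "real ^ 'n"
    have "0 + (\<Sum>j\<in>Basis. (c j * (x \<bullet> j)) *\<^sub>R j) = (\<Sum>i\<in>UNIV. (e i * x $ i) *\<^sub>R axis i 1)"
      by (simp add: basis sum.reindex[OF inj] c_axis inner_axis)
    also have "\<dots> = dil e x"
      by (simp add: vec_eq_iff axis_def if_distrib cong: if_cong)
    finally show "0 + (\<Sum>j\<in>Basis. (c j * (x \<bullet> j)) *\<^sub>R j) = dil e x" .
  qed
  have P: "(\<Prod>j\<in>Basis. \<bar>c j\<bar>) = (\<Prod>i\<in>UNIV. e i)"
    using e by (simp add: basis prod.reindex[OF inj] c_axis abs_of_pos)
  show "lebesgue = density (distr lebesgue lebesgue (dil e)) (\<lambda>_. ennreal (\<Prod>i\<in>UNIV. e i))"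
    using lebesgue_affine_euclidean[where c=c and t=0, OF c] unfolding T P .
  show "dil e \<in> lebesgue \<rightarrow>\<^sub>M lebesgue"
    using lebesgue_affine_measurable[where c=c and t=0, OF c] unfolding T .
qed

lemma AE_dil:
  fixes e :: "'n::finite \<Rightarrow> real"
  assumes e: "\<And>i. e i > 0" and P: "AE x in lebesgue. P x"
  shows "AE x in lebesgue. P (dil e x)"
proof -
  obtain N where N: "N \<in> null_sets lebesgue" "{x. \<not> P x} \<subseteq> N"
    using P by (auto simp: eventually_ae_filter)
  have "negligible (dil (\<lambda>i. 1 / e i) ` N)"
    using N(1)
    by (intro negligible_differentiable_image_negligible linear_imp_differentiable_on
        bounded_linear.linear[OF bounded_linear_dil]) (simp_all add: negligible_iff_null_sets)
  moreover have "{x. \<not> P (dil e x)} \<subseteq> dil (\<lambda>i. 1 / e i) ` N"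
  proof
    fix x assume "x \<in> {x. \<not> P (dil e x)}"
    then have "dil e x \<in> N" using N(2) by auto
    then show "x \<in> dil (\<lambda>i. 1 / e i) ` N"
      by (rule image_eqI[rotated]) (simp add: e)
  qed
  ultimately show ?thesis
    by (auto simp: negligible_iff_null_sets eventually_ae_filter)
qed

lemma measurable_compose_dil:
  fixes f :: "real ^ 'n::finite \<Rightarrow> real"
  assumes e: "\<And>i. e i > 0"
  shows "(\<lambda>x. f (dil e x)) \<in> borel_measurable lebesgue \<longleftrightarrow> f \<in> borel_measurable lebesgue"
proof
  assume *: "(\<lambda>x. f (dil e x)) \<in> borel_measurable lebesgue"
  have "(\<lambda>x. f (dil e (dil (\<lambda>i. 1 / e i) x))) \<in> borel_measurable lebesgue"
    by (rule measurable_compose[OF measurable_dil *]) (use e in auto)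
  then show "f \<in> borel_measurable lebesgue" by (simp add: e)
qed (auto intro: measurable_compose[OF measurable_dil] e)

lemma integrable_dil:
  fixes f :: "real ^ 'n::finite \<Rightarrow> real"
  assumes e: "\<And>i. e i > 0" and f: "integrable lebesgue f"
  shows "integrable lebesgue (\<lambda>x. f (dil e x))"
    and "(LINT x|lebesgue. f (dil e x)) = (LINT x|lebesgue. f x) / (\<Prod>i\<in>UNIV. e i)"
proof -
  let ?P = "\<Prod>i\<in>UNIV. e i" and ?D = "distr lebesgue lebesgue (dil e)"
  have P: "?P > 0" by (simp add: prod_pos e)
  have [measurable]: "dil e \<in> lebesgue \<rightarrow>\<^sub>M lebesgue" "f \<in> borel_measurable lebesgue"
    using f by (auto intro: measurable_dil e)
  have leb: "density ?D (\<lambda>_. ennreal ?P) = lebesgue"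
    using lebesgue_dil(1)[of e, OF e] by (rule sym)
  have "integrable (density ?D (\<lambda>_. ennreal ?P)) f"
    using f by (simp only: leb)
  then have "integrable ?D (\<lambda>x. ?P *\<^sub>R f x)"
    by (subst (asm) integrable_density) (use P in auto)
  then have "integrable lebesgue (\<lambda>x. ?P *\<^sub>R f (dil e x))"
    by (subst (asm) integrable_distr_eq) auto
  then show "integrable lebesgue (\<lambda>x. f (dil e x))"
    using P unfolding real_scaleR_def integrable_mult_left_iff by (metis less_irrefl)
  have "(LINT x|lebesgue. f x) = (LINT x|density ?D (\<lambda>_. ennreal ?P). f x)"
    by (simp only: leb)
  also have "\<dots> = (LINT x|?D. ?P *\<^sub>R f x)"
    by (rule integral_density) (use P in auto)
  also have "\<dots> = (LINT x|lebesgue. ?P *\<^sub>R f (dil e x))"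
    by (rule integral_distr) auto
  finally show "(LINT x|lebesgue. f (dil e x)) = (LINT x|lebesgue. f x) / ?P"
    using P by (simp add: field_simps del: prod_zero_iff)
qed

text \<open>If the integral does not exist, then by the previous lemma for the inverse dilation neither does
  the other one, and both have the default value 0.\<close>

lemma integral_dil:
  fixes f :: "real ^ 'n::finite \<Rightarrow> real"
  assumes e: "\<And>i. e i > 0"
  shows "(LINT x|lebesgue. f (dil e x)) = (LINT x|lebesgue. f x) / (\<Prod>i\<in>UNIV. e i)"
proof (cases "integrable lebesgue f")
  case True
  then show ?thesis by (rule integrable_dil(2)[OF e])
next
  case False
  have "\<not> integrable lebesgue (\<lambda>x. f (dil e x))"
  proof
    assume "integrable lebesgue (\<lambda>x. f (dil e x))"
    then have "integrable lebesgue (\<lambda>x. f (dil e (dil (\<lambda>i. 1 / e i) x)))"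
      by (rule integrable_dil(1)[rotated]) (use e in auto)
    with False show False by (simp add: e)
  qed
  with False show ?thesis by (simp add: not_integrable_integral_eq)
qed

lemma compact_in_sets_lebesgue: "compact K \<Longrightarrow> K \<in> sets lebesgue"
  by (simp add: lmeasurable_compact fmeasurableD)

lemma set_integral_dil_le:
  fixes f :: "real ^ 'n::finite \<Rightarrow> real"
  assumes e: "\<And>i. e i > 0" and f: "\<And>x. 0 \<le> f x" "set_integrable lebesgue L f"
    and K: "K \<in> sets lebesgue" "dil e ` K \<subseteq> L"
  shows "set_integrable lebesgue K (\<lambda>x. f (dil e x))"
    and "(LINT x:K|lebesgue. f (dil e x)) \<le> (LINT x:L|lebesgue. f x) / (\<Prod>i\<in>UNIV. e i)"
proof -
  define F where "F = (\<lambda>x. indicator L x *\<^sub>R f x)"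
  have F: "integrable lebesgue F"
    using f(2) by (simp add: set_integrable_def F_def)
  note FD = integrable_dil[OF e F]
  have eq: "indicator K x *\<^sub>R f (dil e x) = indicator K x *\<^sub>R F (dil e x)" for x
    using K(2) by (auto simp: F_def indicator_def)
  show int: "set_integrable lebesgue K (\<lambda>x. f (dil e x))"
    unfolding set_integrable_def eq
    using integrable_mult_indicator[OF K(1) FD(1)] .
  have "(LINT x:K|lebesgue. f (dil e x)) \<le> (LINT x|lebesgue. F (dil e x))"
    unfolding set_lebesgue_integral_def
  proof (rule integral_mono[OF _ FD(1)])
    show "integrable lebesgue (\<lambda>x. indicator K x *\<^sub>R f (dil e x))"
      using int by (simp add: set_integrable_def)
    show "indicator K x *\<^sub>R f (dil e x) \<le> F (dil e x)" for x
      using f(1) K(2) by (auto simp: F_def indicator_def)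
  qed
  also have "\<dots> = (LINT x:L|lebesgue. f x) / (\<Prod>i\<in>UNIV. e i)"
    using FD(2) by (simp add: F_def set_lebesgue_integral_def)
  finally show "(LINT x:K|lebesgue. f (dil e x)) \<le> (LINT x:L|lebesgue. f x) / (\<Prod>i\<in>UNIV. e i)" .
qed

lemma set_integral_eq_integral:
  fixes f :: "'a \<Rightarrow> real"
  assumes "\<And>x. x \<notin> K \<Longrightarrow> f x = 0"
  shows "(LINT x:K|M. f x) = (LINT x|M. f x)"
  unfolding set_lebesgue_integral_def
  by (rule Bochner_Integration.integral_cong) (use assms in \<open>auto simp: indicator_def\<close>)

lemma compact_dil_image: "compact K \<Longrightarrow> compact (dil e ` K)"
  by (intro compact_continuous_image linear_continuous_on bounded_linear_dil)

lemma Lq_loc_dil: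
  fixes f :: "real ^ 'n::finite \<Rightarrow> real"
  assumes e: "\<And>i. e i > 0" and f: "Lq_loc q UNIV f"
  shows "Lq_loc q UNIV (\<lambda>x. c * f (dil e x))"
  unfolding Lq_loc_def
proof (intro conjI allI impI)
  show "(\<lambda>x. c * f (dil e x)) \<in> borel_measurable (lebesgue_on UNIV)"
    using f measurable_compose_dil[of e f, OF e] by (simp add: Lq_loc_def lebesgue_on_UNIV_eq)
  fix K :: "(real ^ 'n) set" assume K: "compact K \<and> K \<subseteq> UNIV"
  have "set_integrable lebesgue K (\<lambda>x. \<bar>f (dil e x)\<bar> powr q)"
  proof (rule set_integral_dil_le(1)[OF e])
    show "set_integrable lebesgue (dil e ` K) (\<lambda>x. \<bar>f x\<bar> powr q)"
      using f K compact_dil_image[of K e] by (simp add: Lq_loc_def)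
  qed (use K compact_in_sets_lebesgue in auto)
  then show "set_integrable lebesgue K (\<lambda>x. \<bar>c * f (dil e x)\<bar> powr q)"
    by (simp add: abs_mult powr_mult set_integrable_mult_right)
qed

lemma frechet_derivative_eq_0_on_open:
  assumes "open S" "\<And>x. x \<in> S \<Longrightarrow> \<psi> x = (0::real)" "x \<in> S"
  shows "frechet_derivative \<psi> (at x) v = 0"
proof -
  have "(\<psi> has_derivative (\<lambda>_. 0)) (at x)"
    by (rule has_derivative_transform_within_open[where f="\<lambda>_. 0", OF _ assms(1,3)]) (use assms in auto)
  from frechet_derivative_at[OF this] show ?thesis by metis
qed

lemma frechet_derivative_eq_0_outside_support:
  assumes "closed K" "\<And>x. x \<notin> K \<Longrightarrow> \<psi> x = (0::real)" "x \<notin> K"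
  shows "frechet_derivative \<psi> (at x) v = 0"
  by (rule frechet_derivative_eq_0_on_open[of "- K"]) (use assms in auto)

lemma weak_partial_dil:
  fixes f :: "real ^ 'n::finite \<Rightarrow> real"
  assumes e: "\<And>i. e i > 0" and fg: "weak_partial UNIV f i g"
  shows "weak_partial UNIV (\<lambda>x. c * f (dil e x)) i (\<lambda>x. c * e i * g (dil e x))"
  unfolding weak_partial_def
proof (intro allI impI)
  fix K :: "(real ^ 'n) set" and \<psi> :: "real ^ 'n \<Rightarrow> real"
  assume *: "compact K \<and> K \<subseteq> UNIV \<and> smooth_on UNIV \<psi> \<and> (\<forall>x\<in>UNIV - K. \<psi> x = 0)"
  define \<psi>' where "\<psi>' = (\<lambda>y. \<psi> (dil (\<lambda>i. 1 / e i) y))"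
  have \<psi>: "\<psi> x = \<psi>' (dil e x)" for x by (simp add: \<psi>'_def e)
  have smooth: "smooth_on UNIV \<psi>'"
    unfolding \<psi>'_def
  proof (rule smooth_on_compose[where T=UNIV and f=\<psi> and g="dil (\<lambda>i. 1 / e i)"])
    show "smooth_on UNIV (\<lambda>y. dil (\<lambda>i. 1 / e i) y \<bullet> b)" for b
      by (rule smooth_on_bounded_linear[OF open_UNIV
            bounded_linear_compose[OF bounded_linear_inner_left bounded_linear_dil]])
  qed (use * in auto)
  have supp: "\<psi>' y = 0" if "y \<notin> dil e ` K" for y
  proof -
    have "dil (\<lambda>i. 1 / e i) y \<notin> K"
    proof
      assume "dil (\<lambda>i. 1 / e i) y \<in> K"
      then have "dil e (dil (\<lambda>i. 1 / e i) y) \<in> dil e ` K" by (rule imageI)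
      with that show False by (simp add: e)
    qed
    then show ?thesis using * by (simp add: \<psi>'_def)
  qed
  have K': "compact (dil e ` K)" using * compact_dil_image by blast
  have der: "frechet_derivative \<psi> (at x) (axis i 1) = e i * frechet_derivative \<psi>' (at (dil e x)) (axis i 1)" for x
  proof -
    have D: "(\<psi>' has_derivative frechet_derivative \<psi>' (at (dil e x))) (at (dil e x))"
      using smooth_on_imp_has_derivative[OF smooth] by simp
    have "((\<lambda>x. \<psi>' (dil e x)) has_derivative (\<lambda>v. frechet_derivative \<psi>' (at (dil e x)) (dil e v))) (at x)"
      by (rule has_derivative_compose[OF bounded_linear_imp_has_derivative[OF bounded_linear_dil] D])
    then have "frechet_derivative (\<lambda>x. \<psi>' (dil e x)) (at x) =
        (\<lambda>v. frechet_derivative \<psi>' (at (dil e x)) (dil e v))"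
      by (rule frechet_derivative_at[symmetric])
    moreover have "(\<lambda>x. \<psi>' (dil e x)) = \<psi>" by (rule ext) (simp only: \<psi>)
    ultimately have "frechet_derivative \<psi> (at x) =
        (\<lambda>v. frechet_derivative \<psi>' (at (dil e x)) (dil e v))" by simp
    then show ?thesis
      by (simp add: dil_axis linear_scale[OF has_derivative_linear[OF D]])
  qed
  have "(LINT x:dil e ` K|lebesgue. f x * frechet_derivative \<psi>' (at x) (axis i 1)) =
      - (LINT x:dil e ` K|lebesgue. g x * \<psi>' x)"
    using fg K' smooth supp unfolding weak_partial_def by auto
  moreover have "(LINT x:dil e ` K|lebesgue. f x * frechet_derivative \<psi>' (at x) (axis i 1)) =
      (LINT x|lebesgue. f x * frechet_derivative \<psi>' (at x) (axis i 1))"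
    by (rule set_integral_eq_integral)
       (simp add: frechet_derivative_eq_0_outside_support[OF compact_imp_closed[OF K'] supp])
  moreover have "(LINT x:dil e ` K|lebesgue. g x * \<psi>' x) = (LINT x|lebesgue. g x * \<psi>' x)"
    by (rule set_integral_eq_integral) (simp add: supp)
  ultimately have main: "(LINT x|lebesgue. f x * frechet_derivative \<psi>' (at x) (axis i 1)) =
      - (LINT x|lebesgue. g x * \<psi>' x)"
    by simp
  have "(LINT x:K|lebesgue. c * f (dil e x) * frechet_derivative \<psi> (at x) (axis i 1)) =
      (LINT x|lebesgue. c * f (dil e x) * frechet_derivative \<psi> (at x) (axis i 1))"
    using * by (intro set_integral_eq_integral)
       (auto simp: frechet_derivative_eq_0_outside_support[of K] compact_imp_closed)
  also have "\<dots> = (LINT x|lebesgue. (c * e i) *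
      (f (dil e x) * frechet_derivative \<psi>' (at (dil e x)) (axis i 1)))"
    by (simp add: der algebra_simps)
  also have "\<dots> = (c * e i) * (- (LINT x|lebesgue. g x * \<psi>' x) / (\<Prod>i\<in>UNIV. e i))"
    using integral_dil[OF e, where f="\<lambda>y. f y * frechet_derivative \<psi>' (at y) (axis i 1)"]
    by (simp add: main)
  also have "\<dots> = - (LINT x|lebesgue. (c * e i) * (g (dil e x) * \<psi>' (dil e x)))"
    using integral_dil[OF e, where f="\<lambda>y. g y * \<psi>' y"] by simp
  also have "\<dots> = - (LINT x:K|lebesgue. c * e i * g (dil e x) * \<psi> x)"
    using * by (subst set_integral_eq_integral) (auto simp: \<psi>[symmetric] algebra_simps)
  finally show "(LINT x:K|lebesgue. c * f (dil e x) * frechet_derivative \<psi> (at x) (axis i 1)) =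
      - (LINT x:K|lebesgue. c * e i * g (dil e x) * \<psi> x)" .
qed

lemma W11_loc_dil:
  assumes "\<And>i. e i > 0" "W11_loc UNIV f G"
  shows "W11_loc UNIV (\<lambda>x. c * f (dil e x)) (\<lambda>i x. c * e i * G i (dil e x))"
  using assms by (auto simp: W11_loc_def intro!: Lq_loc_dil weak_partial_dil)

section \<open>Continuity of dilations in the mean\<close>

lemma Lq_loc_2_D:
  assumes "Lq_loc 2 UNIV v"
  shows "v \<in> borel_measurable lebesgue"
    and "compact K \<Longrightarrow> set_integrable lebesgue K (\<lambda>x. (v x)\<^sup>2)"
  using assms by (auto simp: Lq_loc_def)

lemma set_integrable_sq_add:
  fixes f g :: "'a \<Rightarrow> real"
  assumes "set_integrable M K (\<lambda>x. (f x)\<^sup>2)" "set_integrable M K (\<lambda>x. (g x)\<^sup>2)"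
    and "f \<in> borel_measurable M" "g \<in> borel_measurable M" "K \<in> sets M"
  shows "set_integrable M K (\<lambda>x. (f x + g x)\<^sup>2)"
    and "(LINT x:K|M. (f x + g x)\<^sup>2) \<le> 2 * (LINT x:K|M. (f x)\<^sup>2) + 2 * (LINT x:K|M. (g x)\<^sup>2)"
proof -
  have le: "(f x + g x)\<^sup>2 \<le> 2 * (f x)\<^sup>2 + 2 * (g x)\<^sup>2" for x
    using sum_squares_bound[of "f x" "g x"] by (simp add: power2_sum)
  have int: "set_integrable M K (\<lambda>x. 2 * (f x)\<^sup>2 + 2 * (g x)\<^sup>2)"
    using assms by (intro set_integral_add set_integrable_mult_right) auto
  show *: "set_integrable M K (\<lambda>x. (f x + g x)\<^sup>2)"
  proof (rule set_integrable_bound[OF int])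
    show "set_borel_measurable M K (\<lambda>x. (f x + g x)\<^sup>2)"
      unfolding set_borel_measurable_def using assms by measurable
  qed (use le in auto)
  have "(LINT x:K|M. (f x + g x)\<^sup>2) \<le> (LINT x:K|M. 2 * (f x)\<^sup>2 + 2 * (g x)\<^sup>2)"
    by (rule set_integral_mono[OF * int]) (use le in auto)
  also have "\<dots> = 2 * (LINT x:K|M. (f x)\<^sup>2) + 2 * (LINT x:K|M. (g x)\<^sup>2)"
    using assms by (subst set_integral_add) auto
  finally show "(LINT x:K|M. (f x + g x)\<^sup>2) \<le> 2 * (LINT x:K|M. (f x)\<^sup>2) + 2 * (LINT x:K|M. (g x)\<^sup>2)" .
qed

lemma set_integral_dominated_convergence:
  fixes f :: "nat \<Rightarrow> 'a \<Rightarrow> real"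
  assumes "K \<in> sets M" "f0 \<in> borel_measurable M" "\<And>n. f n \<in> borel_measurable M"
    and "set_integrable M K w"
    and "AE x in M. x \<in> K \<longrightarrow> (\<lambda>n. f n x) \<longlonglongrightarrow> f0 x"
    and "\<And>n x. x \<in> K \<Longrightarrow> \<bar>f n x\<bar> \<le> w x"
  shows "(\<lambda>n. LINT x:K|M. f n x) \<longlonglongrightarrow> (LINT x:K|M. f0 x)"
  unfolding set_lebesgue_integral_def
proof (rule integral_dominated_convergence)
  show "integrable M (\<lambda>x. indicator K x *\<^sub>R w x)"
    using assms(4) by (simp add: set_integrable_def)
  show "AE x in M. (\<lambda>n. indicator K x *\<^sub>R f n x) \<longlonglongrightarrow> indicator K x *\<^sub>R f0 x"
    using assms(5) by eventually_elim (auto simp: indicator_def)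
  show "AE x in M. norm (indicator K x *\<^sub>R f n x) \<le> indicator K x *\<^sub>R w x" for n
    using assms(6) by (intro always_eventually) (auto simp: indicator_def)
qed (use assms in \<open>auto intro!: borel_measurable_times\<close>)

lemma set_integrable_const_compact:
  fixes K :: "'a::euclidean_space set" and c :: real
  assumes "compact K" shows "set_integrable lebesgue K (\<lambda>x. c)"
proof -
  have "integrable lebesgue (indicator K :: 'a \<Rightarrow> real)"
    using lmeasurable_compact[OF assms] by (simp add: lmeasurable_iff_integrable)
  then show ?thesis by (simp add: set_integrable_def)
qed

text \<open>Truncation reduces to bounded \<open>v\<close>; a bounded measurable function is almost everywhere the
  limit of continuous functions, which may be truncated as well, so that dominated convergence
  applies in both steps.\<close>

lemma L2_approx_continuous:
  fixes v :: "'a::euclidean_space \<Rightarrow> real"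
  assumes v: "Lq_loc 2 UNIV v" and K: "compact K" and "\<epsilon> > 0"
  obtains g where "continuous_on UNIV g" "set_integrable lebesgue K (\<lambda>x. (v x - g x)\<^sup>2)"
    "(LINT x:K|lebesgue. (v x - g x)\<^sup>2) < \<epsilon>"
proof -
  define cl where "cl = (\<lambda>M t :: real. max (- M) (min M t))"
  have cl_borel [measurable]: "cl M \<in> borel_measurable borel" for M by (simp add: cl_def)
  have vm [measurable]: "v \<in> borel_measurable lebesgue" and vi: "set_integrable lebesgue K (\<lambda>x. (v x)\<^sup>2)"
    using Lq_loc_2_D[OF v] K by auto
  have Km [measurable]: "K \<in> sets lebesgue" by (rule compact_in_sets_lebesgue[OF K])
  have "(\<lambda>n. LINT x:K|lebesgue. (v x - cl (real n) (v x))\<^sup>2) \<longlonglongrightarrow> (LINT x:K|lebesgue. 0)"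
  proof (rule set_integral_dominated_convergence[OF _ _ _ vi])
    show "AE x in lebesgue. x \<in> K \<longrightarrow> (\<lambda>n. (v x - cl (real n) (v x))\<^sup>2) \<longlonglongrightarrow> 0"
    proof (intro always_eventually allI impI)
      fix x
      obtain m where "\<bar>v x\<bar> \<le> real m" using real_arch_simple by blast
      then have "\<forall>\<^sub>F n in sequentially. (v x - cl (real n) (v x))\<^sup>2 = 0"
        by (auto simp: eventually_sequentially cl_def intro!: exI[of _ m])
      then show "(\<lambda>n. (v x - cl (real n) (v x))\<^sup>2) \<longlonglongrightarrow> 0"
        by (rule tendsto_eventually)
    qed
    show "\<bar>(v x - cl (real n) (v x))\<^sup>2\<bar> \<le> (v x)\<^sup>2" for n x
    proof -
      have "\<bar>v x - cl (real n) (v x)\<bar> \<le> \<bar>v x\<bar>" by (auto simp: cl_def)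
      then show ?thesis by (simp add: abs_le_square_iff)
    qed
  qed auto
  then have "(\<lambda>n. LINT x:K|lebesgue. (v x - cl (real n) (v x))\<^sup>2) \<longlonglongrightarrow> 0" by simp
  then obtain n where n: "(LINT x:K|lebesgue. (v x - cl (real n) (v x))\<^sup>2) < \<epsilon>"
    using order_tendstoD(2)[OF _ \<open>\<epsilon> > 0\<close>] by (force simp: eventually_sequentially)
  let ?M = "real n"
  have "v measurable_on UNIV"
    by (rule lebesgue_measurable_imp_measurable_on) auto
  then obtain N h where N: "negligible N" and h: "\<And>k. continuous_on UNIV (h k)"
    and lim: "\<And>x. x \<notin> N \<Longrightarrow> (\<lambda>k. h k x) \<longlonglongrightarrow> v x"
    by (auto simp: measurable_on_def)
  have hb [measurable]: "h k \<in> borel_measurable lebesgue" for k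
    using borel_measurable_continuous_onI[OF h] by (simp add: measurable_completion)
  have dom: "set_integrable lebesgue K (\<lambda>x. 2 * (v x)\<^sup>2 + 2 * ?M\<^sup>2)"
    by (intro set_integral_add set_integrable_mult_right vi set_integrable_const_compact K)
  have bd: "\<bar>(v x - cl ?M (h k x))\<^sup>2\<bar> \<le> 2 * (v x)\<^sup>2 + 2 * ?M\<^sup>2" for k x
  proof -
    have "\<bar>cl ?M (h k x)\<bar> \<le> ?M" by (auto simp: cl_def)
    then have "(cl ?M (h k x))\<^sup>2 \<le> ?M\<^sup>2" using abs_le_square_iff by force
    moreover have "(v x - cl ?M (h k x))\<^sup>2 \<le> 2 * (v x)\<^sup>2 + 2 * (cl ?M (h k x))\<^sup>2"
      using sum_squares_bound[of "v x" "- cl ?M (h k x)"] by (simp add: power2_diff)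
    ultimately show ?thesis by simp
  qed
  have "(\<lambda>k. LINT x:K|lebesgue. (v x - cl ?M (h k x))\<^sup>2) \<longlonglongrightarrow> (LINT x:K|lebesgue. (v x - cl ?M (v x))\<^sup>2)"
  proof (rule set_integral_dominated_convergence[OF _ _ _ dom])
    have "AE x in lebesgue. x \<notin> N"
      using N by (simp add: negligible_iff_null_sets AE_not_in)
    then show "AE x in lebesgue. x \<in> K \<longrightarrow>
        (\<lambda>k. (v x - cl ?M (h k x))\<^sup>2) \<longlonglongrightarrow> (v x - cl ?M (v x))\<^sup>2"
      unfolding cl_def by eventually_elim (auto intro!: tendsto_intros lim)
  qed (use bd in auto)
  from order_tendstoD(2)[OF this n] obtain k where k: "(LINT x:K|lebesgue. (v x - cl ?M (h k x))\<^sup>2) < \<epsilon>"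
    by (force simp: eventually_sequentially)
  show ?thesis
  proof
    show "continuous_on UNIV (\<lambda>x. cl ?M (h k x))"
      unfolding cl_def by (intro continuous_intros h)
    show "set_integrable lebesgue K (\<lambda>x. (v x - cl ?M (h k x))\<^sup>2)"
      by (rule set_integrable_bound[OF dom]) (use bd in \<open>auto simp: set_borel_measurable_def\<close>)
  qed (rule k)
qed

text \<open>For continuous \<open>g\<close> in place of \<open>v\<close> this is dominated convergence, and replacing \<open>v\<close> by a
  continuous approximant costs little, uniformly in \<open>n\<close>, because the dilations distort the \<open>L\<^sup>2\<close>
  norm by bounded factors.\<close>

lemma dil_continuous_L2:
  fixes v :: "real ^ 'n::finite \<Rightarrow> real" and e :: "nat \<Rightarrow> 'n \<Rightarrow> real"
  assumes v: "Lq_loc 2 UNIV v" and K: "compact K"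
    and e: "\<And>n i. e n i > 0" "\<And>i. e0 i > 0" "\<And>i. (\<lambda>n. e n i) \<longlonglongrightarrow> e0 i"
    and c: "c \<longlonglongrightarrow> c0"
  shows "(\<lambda>n. LINT x:K|lebesgue. (c n * v (dil (e n) x) - c0 * v (dil e0 x))\<^sup>2) \<longlonglongrightarrow> 0"
proof (rule LIMSEQ_I)
  fix \<epsilon> :: real assume "\<epsilon> > 0"
  have Km [measurable]: "K \<in> sets lebesgue" by (rule compact_in_sets_lebesgue[OF K])
  have vm [measurable]: "v \<in> borel_measurable lebesgue" using Lq_loc_2_D[OF v] by auto
  define P where "P = (\<lambda>n. \<Prod>i\<in>UNIV. e n i)"
  define P0 where "P0 = (\<Prod>i\<in>UNIV. e0 i)"
  have P: "P n > 0" "P0 > 0" for n by (auto simp: P_def P0_def prod_pos e)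
  have "(\<lambda>n. (c n)\<^sup>2 / P n) \<longlonglongrightarrow> c0\<^sup>2 / P0"
    unfolding P_def P0_def
    by (intro tendsto_intros c e(3)) (use P(2) in \<open>simp add: P0_def del: prod_zero_iff\<close>)
  then have "Bseq (\<lambda>n. (c n)\<^sup>2 / P n)" by (rule convergent_imp_Bseq[OF convergentI])
  then obtain A where A: "A > 0" "\<forall>n. norm ((c n)\<^sup>2 / P n) \<le> A" by (rule BseqE)
  define A' where "A' = max A (c0\<^sup>2 / P0)"
  have A': "A' > 0" "c0\<^sup>2 / P0 \<le> A'"
    using A(1) by (simp_all add: A'_def less_max_iff_disj)
  have A'c: "(c n)\<^sup>2 / P n \<le> A'" for n
  proof -
    have "(c n)\<^sup>2 / P n \<le> norm ((c n)\<^sup>2 / P n)" unfolding real_norm_def by (rule abs_ge_self)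
    also have "\<dots> \<le> A" using A(2) by blast
    also have "\<dots> \<le> A'" by (simp add: A'_def)
    finally show ?thesis .
  qed
  have "\<exists>B. \<forall>n. \<bar>e n i\<bar> \<le> B" for i
  proof -
    have "Bseq (\<lambda>n. e n i)" by (rule convergent_imp_Bseq[OF convergentI[OF e(3)]])
    then show ?thesis by (auto simp: Bseq_def)
  qed
  then obtain b where b: "\<And>i n. \<bar>e n i\<bar> \<le> b i" by metis
  define B where "B = Max (range b)"
  have B: "\<bar>e n i\<bar> \<le> B" for n i
  proof -
    have "b i \<le> B" unfolding B_def by (rule Max_ge) auto
    then show ?thesis using b[of n i] by linarith
  qed
  have B0: "\<bar>e0 i\<bar> \<le> B" for i
    by (rule LIMSEQ_le_const2[OF tendsto_rabs[OF e(3)[of i]]]) (use B in auto)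
  obtain r where r: "\<And>x. x \<in> K \<Longrightarrow> norm x \<le> r"
    using compact_imp_bounded[OF K] by (auto simp: bounded_iff)
  define L where "L = cball (0 :: real ^ 'n) (B * r)"
  have B_nonneg: "B \<ge> 0" by (rule order_trans[OF abs_ge_zero B0])
  have in_L: "dil f ` K \<subseteq> L" if "\<And>i. \<bar>f i\<bar> \<le> B" for f
  proof
    fix y assume "y \<in> dil f ` K"
    then obtain x where x: "x \<in> K" "y = dil f x" by blast
    have "norm y \<le> B * norm x" unfolding x(2) by (rule norm_dil_le[OF that])
    also have "\<dots> \<le> B * r" by (rule mult_left_mono[OF r[OF x(1)] B_nonneg])
    finally show "y \<in> L" by (simp add: L_def)
  qed
  have KL: "dil (e n) ` K \<subseteq> L" for n by (rule in_L[OF B])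
  have KL0: "dil e0 ` K \<subseteq> L" by (rule in_L[OF B0])
  have L: "compact L" by (simp add: L_def)
  \<comment> \<open>Twice squaring a sum costs a factor 4, so the two approximation errors amount to
    \<open>8 A' \<delta> = \<epsilon> / 2\<close>.\<close>
  define \<delta> where "\<delta> = \<epsilon> / (16 * A')"
  have "\<delta> > 0" using \<open>\<epsilon> > 0\<close> A' by (simp add: \<delta>_def)
  then obtain g where g: "continuous_on UNIV g" "set_integrable lebesgue L (\<lambda>x. (v x - g x)\<^sup>2)"
    "(LINT x:L|lebesgue. (v x - g x)\<^sup>2) < \<delta>"
    by (rule L2_approx_continuous[OF v L])
  have gm [measurable]: "g \<in> borel_measurable lebesgue"
    using borel_measurable_continuous_onI[OF g(1)] by (simp add: measurable_completion)
  \<comment> \<open>The bound \<open>A'\<close> makes the approximation error after a dilation uniformly small.\<close>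
  have err: "set_integrable lebesgue K (\<lambda>x. (a * (v (dil f x) - g (dil f x)))\<^sup>2)"
      "(LINT x:K|lebesgue. (a * (v (dil f x) - g (dil f x)))\<^sup>2) \<le> A' * \<delta>"
    if f: "\<And>i. f i > 0" "dil f ` K \<subseteq> L" "a\<^sup>2 / (\<Prod>i\<in>UNIV. f i) \<le> A'" for a f
  proof -
    note * = set_integral_dil_le[OF f(1) _ g(2) Km f(2)]
    show "set_integrable lebesgue K (\<lambda>x. (a * (v (dil f x) - g (dil f x)))\<^sup>2)"
      unfolding power_mult_distrib using *(1) by (intro set_integrable_mult_right) auto
    have "(LINT x:K|lebesgue. (a * (v (dil f x) - g (dil f x)))\<^sup>2) =
        a\<^sup>2 * (LINT x:K|lebesgue. (v (dil f x) - g (dil f x))\<^sup>2)"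
      by (simp add: power_mult_distrib)
    also have "\<dots> \<le> a\<^sup>2 * ((LINT x:L|lebesgue. (v x - g x)\<^sup>2) / (\<Prod>i\<in>UNIV. f i))"
      by (rule mult_left_mono[OF *(2)]) auto
    also have "\<dots> = (a\<^sup>2 / (\<Prod>i\<in>UNIV. f i)) * (LINT x:L|lebesgue. (v x - g x)\<^sup>2)" by simp
    also have "\<dots> \<le> A' * \<delta>"
      by (rule mult_mono) (use f(3) g(3) A' in \<open>auto simp: set_lebesgue_integral_def\<close>)
    finally show "(LINT x:K|lebesgue. (a * (v (dil f x) - g (dil f x)))\<^sup>2) \<le> A' * \<delta>" .
  qed
  obtain G where G: "\<And>x. x \<in> L \<Longrightarrow> \<bar>g x\<bar> \<le> G"
    using compact_imp_bounded[OF compact_continuous_image[OF continuous_on_subset[OF g(1)] L]]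
    by (auto simp: bounded_iff)
  have "Bseq c" by (rule convergent_imp_Bseq[OF convergentI[OF c]])
  then obtain C where C: "\<And>n. \<bar>c n\<bar> \<le> C"
    by (auto simp: Bseq_def)
  have C0: "\<bar>c0\<bar> \<le> C"
    by (rule LIMSEQ_le_const2[OF tendsto_rabs[OF c]]) (use C in auto)
  have meas [measurable]: "(\<lambda>x. f (dil h x)) \<in> borel_measurable lebesgue"
    if "f \<in> borel_measurable lebesgue" "\<And>i. h i > 0" for f :: "real ^ 'n \<Rightarrow> real" and h
    using that measurable_compose_dil by blast
  note [measurable] = meas[OF vm e(1)] meas[OF gm e(1)] meas[OF vm e(2)] meas[OF gm e(2)]
  let ?m = "\<lambda>n x. c n * g (dil (e n) x) - c0 * g (dil e0 x)"
  have const: "set_integrable lebesgue K (\<lambda>x. (2 * (C * G))\<^sup>2)"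
    by (rule set_integrable_const_compact[OF K])
  have bd: "\<bar>(?m n x)\<^sup>2\<bar> \<le> (2 * (C * G))\<^sup>2" if "x \<in> K" for n x
  proof -
    have "\<bar>c n * g (dil (e n) x)\<bar> \<le> C * G" "\<bar>c0 * g (dil e0 x)\<bar> \<le> C * G"
      unfolding abs_mult using that KL KL0 G C C0 order_trans[OF abs_ge_zero C]
      by (auto intro!: mult_mono)
    then have "\<bar>?m n x\<bar> \<le> \<bar>2 * (C * G)\<bar>" by linarith
    then show ?thesis by (simp only: abs_le_square_iff abs_power2)
  qed
  have "(\<lambda>n. LINT x:K|lebesgue. (?m n x)\<^sup>2) \<longlonglongrightarrow> (LINT x:K|lebesgue. 0)"
  proof (rule set_integral_dominated_convergence[OF _ _ _ const])
    have "(\<lambda>n. (?m n x)\<^sup>2) \<longlonglongrightarrow> 0" for x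
    proof -
      have "(\<lambda>n. dil (e n) x) \<longlonglongrightarrow> dil e0 x"
        by (rule vec_tendstoI) (auto intro!: tendsto_intros e(3))
      then have "(\<lambda>n. g (dil (e n) x)) \<longlonglongrightarrow> g (dil e0 x)"
        by (rule isCont_tendsto_compose[rotated])
           (use g(1) in \<open>simp add: continuous_on_eq_continuous_at\<close>)
      from tendsto_power[OF tendsto_diff[OF tendsto_mult[OF c this] tendsto_const[of "c0 * g (dil e0 x)"]], of 2]
      show ?thesis by simp
    qed
    then show "AE x in lebesgue. x \<in> K \<longrightarrow> (\<lambda>n. (?m n x)\<^sup>2) \<longlonglongrightarrow> 0" by auto
  qed (use bd in auto)
  then have "\<forall>\<^sub>F n in sequentially. (LINT x:K|lebesgue. (?m n x)\<^sup>2) < \<epsilon> / 8"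
    using \<open>\<epsilon> > 0\<close> by (intro order_tendstoD(2)) auto
  then obtain n0 where n0: "\<And>n. n \<ge> n0 \<Longrightarrow> (LINT x:K|lebesgue. (?m n x)\<^sup>2) < \<epsilon> / 8"
    by (auto simp: eventually_sequentially)
  have mi: "set_integrable lebesgue K (\<lambda>x. (?m n x)\<^sup>2)" for n
    by (rule set_integrable_bound[OF const]) (use bd in \<open>auto simp: set_borel_measurable_def\<close>)
  show "\<exists>n0. \<forall>n\<ge>n0. norm ((LINT x:K|lebesgue. (c n * v (dil (e n) x) - c0 * v (dil e0 x))\<^sup>2) - 0) < \<epsilon>"
  proof (intro exI allI impI)
    fix n assume n: "n \<ge> n0"
    let ?a = "\<lambda>x. c n * (v (dil (e n) x) - g (dil (e n) x))"
    let ?b = "\<lambda>x. (- c0) * (v (dil e0 x) - g (dil e0 x))"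
    have ea: "set_integrable lebesgue K (\<lambda>x. (?a x)\<^sup>2)" "(LINT x:K|lebesgue. (?a x)\<^sup>2) \<le> A' * \<delta>"
      using err[OF e(1) KL, of "c n" n] A'c[of n] by (auto simp: P_def)
    have eb: "set_integrable lebesgue K (\<lambda>x. (?b x)\<^sup>2)" "(LINT x:K|lebesgue. (?b x)\<^sup>2) \<le> A' * \<delta>"
      using err[OF e(2) KL0, of "- c0"] A'(2) by (auto simp: P0_def)
    note ab = set_integrable_sq_add[OF ea(1) eb(1) _ _ Km]
    have "(LINT x:K|lebesgue. ((?a x + ?b x) + ?m n x)\<^sup>2) \<le>
        2 * (LINT x:K|lebesgue. (?a x + ?b x)\<^sup>2) + 2 * (LINT x:K|lebesgue. (?m n x)\<^sup>2)"
      by (rule set_integrable_sq_add(2)[OF ab(1) mi _ _ Km]) measurable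
    also have "\<dots> \<le> 2 * (2 * (A' * \<delta>) + 2 * (A' * \<delta>)) + 2 * (LINT x:K|lebesgue. (?m n x)\<^sup>2)"
    proof -
      have "(LINT x:K|lebesgue. (?a x + ?b x)\<^sup>2) \<le>
          2 * (LINT x:K|lebesgue. (?a x)\<^sup>2) + 2 * (LINT x:K|lebesgue. (?b x)\<^sup>2)"
        by (rule ab(2)) measurable
      also have "\<dots> \<le> 2 * (A' * \<delta>) + 2 * (A' * \<delta>)"
        by (intro add_mono mult_left_mono ea(2) eb(2)) simp_all
      finally show ?thesis by (intro add_mono mult_left_mono order_refl) simp_all
    qed
    also have "\<dots> < \<epsilon>"
      using n0[OF n] A'(1) \<open>\<epsilon> > 0\<close> by (simp add: \<delta>_def)
    finally have "(LINT x:K|lebesgue. (c n * v (dil (e n) x) - c0 * v (dil e0 x))\<^sup>2) < \<epsilon>"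
      by (simp add: algebra_simps)
    moreover have "0 \<le> (LINT x:K|lebesgue. (c n * v (dil (e n) x) - c0 * v (dil e0 x))\<^sup>2)"
      by (simp add: set_lebesgue_integral_def)
    ultimately show "norm ((LINT x:K|lebesgue. (c n * v (dil (e n) x) - c0 * v (dil e0 x))\<^sup>2) - 0) < \<epsilon>"
      by simp
  qed
qed

section \<open>Coordinate changes\<close>

text \<open>Slices of a Lebesgue measurable function are measurable only for almost every \<open>t\<close>;
  replacing the function by a Borel function almost everywhere makes Tonelli's theorem
  applicable.\<close>

lemma measurable_integral_slices:
  fixes H :: "'a::euclidean_space \<times> real \<Rightarrow> real"
  assumes H: "H \<in> borel_measurable lebesgue"
    and slices: "AE t in lebesgue. (\<lambda>x. H (x, t)) \<in> borel_measurable lebesgue"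
  shows "(\<lambda>t. LINT x|lebesgue. H (x, t)) \<in> borel_measurable lebesgue"
proof -
  obtain H' where H' [measurable]: "H' \<in> borel_measurable lborel" and eq: "AE z in lborel. H z = H' z"
    using completion_ex_borel_measurable_real[OF H] by auto
  interpret lborel_pair: pair_sigma_finite "lborel :: 'a measure" "lborel :: real measure" ..
  obtain N where N: "N \<in> null_sets lborel" "{z. H z \<noteq> H' z} \<subseteq> N"
    using eq by (auto simp: eventually_ae_filter)
  have Ns: "N \<in> sets (lborel \<Otimes>\<^sub>M lborel)" unfolding lborel_prod using N(1) by (rule null_setsD2)
  have "AE z in lborel \<Otimes>\<^sub>M lborel. z \<notin> N"
    unfolding lborel_prod by (rule AE_not_in[OF N(1)])
  then have "AE x in lborel. AE t in lborel. (x, t) \<notin> N"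
    by (rule lborel_pair.AE_pair)
  then have "AE t in lborel. AE x in lborel. (x, t) \<notin> N"
  proof (subst (asm) lborel_pair.AE_commute)
    show "{z \<in> space (lborel \<Otimes>\<^sub>M lborel). (fst z, snd z) \<notin> N} \<in> sets (lborel \<Otimes>\<^sub>M lborel)"
      using sets.compl_sets[OF Ns] by (simp add: set_diff_eq)
  qed
  then have "AE t in lborel. AE x in lebesgue. H (x, t) = H' (x, t)"
  proof eventually_elim
    case (elim t)
    then have "AE x in lborel. H (x, t) = H' (x, t)"
      by eventually_elim (use N(2) in auto)
    then show ?case by (rule AE_completion)
  qed
  then have AE1: "AE t in lebesgue. AE x in lebesgue. H (x, t) = H' (x, t)"
    by (rule AE_completion)
  have slice' [measurable]: "(\<lambda>x. H' (x, t)) \<in> borel_measurable lborel" for t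
    by measurable
  have "AE t in lebesgue. (LINT x|lborel. H' (x, t)) = (LINT x|lebesgue. H (x, t))"
    using AE1 slices
  proof eventually_elim
    case (elim t)
    have "(LINT x|lebesgue. H (x, t)) = (LINT x|lebesgue. H' (x, t))"
      by (rule integral_cong_AE[OF elim(2) measurable_completion[OF slice'] elim(1)])
    then show ?case by (simp add: integral_completion[OF slice'])
  qed
  moreover have "(\<lambda>t. LINT x|lborel. H' (x, t)) \<in> borel_measurable lebesgue"
  proof (rule measurable_completion, rule lborel.borel_measurable_lebesgue_integral)
    have swap: "(\<lambda>z :: real \<times> 'a. (snd z, fst z)) \<in> borel_measurable borel"
      by (intro borel_measurable_continuous_onI continuous_intros)
    have "(\<lambda>z. H' (snd z, fst z)) \<in> borel_measurable borel"
      by (rule measurable_compose[OF swap]) (use H' in simp)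
    then have "(\<lambda>z. H' (snd z, fst z)) \<in> borel_measurable (lborel \<Otimes>\<^sub>M lborel)"
      unfolding lborel_prod by simp
    then show "(\<lambda>(t, x). H' (x, t)) \<in> borel_measurable (lborel \<Otimes>\<^sub>M lborel)"
      by (simp add: case_prod_unfold)
  qed
  ultimately show ?thesis by (rule borel_measurable_AE[rotated])
qed

text \<open>Both \<open>\<Phi>\<close> and its inverse substitute \<open>(y, s) = (dil (E t) x, \<tau> t)\<close>, an increasing change of
  time combined with a time-dependent dilation; this locale treats them together. \<open>\<sigma>\<close> is the
  inverse of \<open>\<tau>\<close>, and smoothness is asked for in the direction in which test functions are
  transported.\<close>

locale coordinate_change =
  fixes I J :: "real set" and \<tau> \<tau>' \<sigma> :: "real \<Rightarrow> real"
    and E E' :: "real \<Rightarrow> 'n::finite \<Rightarrow> real"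
  assumes open_I: "open I" and open_J: "open J"
    and interval_I: "is_interval I" and interval_J: "is_interval J"
    and \<tau>_in: "t \<in> I \<Longrightarrow> \<tau> t \<in> J" and \<sigma>_in: "s \<in> J \<Longrightarrow> \<sigma> s \<in> I"
    and \<sigma>_\<tau>: "t \<in> I \<Longrightarrow> \<sigma> (\<tau> t) = t" and \<tau>_\<sigma>: "s \<in> J \<Longrightarrow> \<tau> (\<sigma> s) = s"
    and \<tau>_deriv: "t \<in> I \<Longrightarrow> (\<tau> has_real_derivative \<tau>' t) (at t)"
    and \<tau>'_pos: "t \<in> I \<Longrightarrow> 0 < \<tau>' t" and \<tau>'_cont: "continuous_on I \<tau>'"
    and E_pos: "t \<in> I \<Longrightarrow> 0 < E t i"
    and E_deriv: "t \<in> I \<Longrightarrow> ((\<lambda>t. E t i) has_real_derivative E' t i) (at t)"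
    and smooth_\<sigma>: "smooth_on J \<sigma>"
    and smooth_E: "smooth_on J (\<lambda>s. 1 / E (\<sigma> s) i)"
begin

abbreviation jac :: "real \<Rightarrow> real" where "jac t \<equiv> (\<Prod>i\<in>UNIV. E t i)"

text \<open>The factor \<open>c\<close> is \<open>jac\<close> for solutions, which makes the substitution preserve mass, and
  \<open>jac t * E t i\<close> for their partial derivatives.\<close>

definition pullback :: "(real \<Rightarrow> real) \<Rightarrow> ((real ^ 'n) \<times> real \<Rightarrow> real) \<Rightarrow> (real ^ 'n) \<times> real \<Rightarrow> real" where
  "pullback c f = (\<lambda>(x, t). c t * f (dil (E t) x, \<tau> t))"

lemma pullback_apply [simp]: "pullback c f (x, t) = c t * f (dil (E t) x, \<tau> t)"
  by (simp add: pullback_def)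

definition inv_chart :: "(real ^ 'n) \<times> real \<Rightarrow> (real ^ 'n) \<times> real" where
  "inv_chart z = (dil (\<lambda>i. 1 / E (\<sigma> (snd z)) i) (fst z), \<sigma> (snd z))"

lemma jac_pos: "t \<in> I \<Longrightarrow> 0 < jac t"
  by (simp add: prod_pos E_pos)

lemma cont_\<tau>: "continuous_on I \<tau>"
  using \<tau>_deriv DERIV_isCont by (auto intro!: continuous_at_imp_continuous_on)

lemma cont_E: "continuous_on I (\<lambda>t. E t i)"
  using E_deriv DERIV_isCont by (fast intro!: continuous_at_imp_continuous_on)

lemma cont_jac: "continuous_on I jac"
  by (intro continuous_on_prod cont_E)

lemma inj_\<tau>: "inj_on \<tau> I"
  by (rule inj_on_inverseI[where g=\<sigma>]) (rule \<sigma>_\<tau>)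

lemma \<tau>_strict_mono:
  assumes "t1 \<in> I" "t2 \<in> I" "t1 < t2" shows "\<tau> t1 < \<tau> t2"
proof (rule DERIV_pos_imp_increasing[OF assms(3)])
  fix t assume "t1 \<le> t" "t \<le> t2"
  then have "t \<in> I" using interval_I assms(1,2) mem_is_interval_1_I by blast
  then show "\<exists>y. DERIV \<tau> t :> y \<and> 0 < y" using \<tau>_deriv \<tau>'_pos by blast
qed

lemma J_lebesgue: "J \<in> sets lebesgue" "UNIV \<times> J \<in> sets lebesgue"
  using open_J by (simp_all add: borel_open open_Times)

lemma I_lebesgue: "I \<in> sets lebesgue" "UNIV \<times> I \<in> sets lebesgue"
  using open_I by (simp_all add: borel_open open_Times)

lemma smooth_inv_chart:
  assumes b: "b \<in> Basis" shows "smooth_on (UNIV \<times> J) (\<lambda>z. inv_chart z \<bullet> b)"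
proof -
  have op: "open ((UNIV :: (real ^ 'n) set) \<times> J)" by (intro open_Times open_UNIV open_J)
  have snd: "smooth_on ((UNIV :: (real ^ 'n) set) \<times> J) (\<lambda>z. snd z)"
    by (rule smooth_on_bounded_linear[OF op bounded_linear_snd])
  have sub: "snd ` (UNIV \<times> J) \<subseteq> J" by auto
  consider i where "b = (axis i 1, 0)" | "b = (0, 1)"
    using b by (auto simp: Basis_prod_def Basis_vec_def)
  then show ?thesis
  proof cases
    case (1 i)
    have "smooth_on (UNIV \<times> J) (\<lambda>z :: (real ^ 'n) \<times> real. fst z \<bullet> axis i 1)"
      by (rule smooth_on_bounded_linear[OF op
            bounded_linear_compose[OF bounded_linear_inner_left bounded_linear_fst]])
    from smooth_on_mult[OF op smooth_on_compose_real[OF op open_J sub smooth_E snd] this]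
    have "smooth_on (UNIV \<times> J) (\<lambda>z :: (real ^ 'n) \<times> real. 1 / E (\<sigma> (snd z)) i * (fst z \<bullet> axis i 1))"
      by blast
    then show ?thesis using 1 by (simp add: inv_chart_def inner_axis)
  next
    case 2
    then show ?thesis
      using smooth_on_compose_real[OF op open_J sub smooth_\<sigma> snd] by (simp add: inv_chart_def)
  qed
qed

lemma differentiable_inv_chart: "inv_chart differentiable_on UNIV \<times> J"
proof (rule differentiable_at_imp_differentiable_on)
  fix z assume z: "z \<in> (UNIV :: (real ^ 'n) set) \<times> J"
  show "inv_chart differentiable at z"
    unfolding differentiable_componentwise_within[of inv_chart]
    using smooth_on_imp_has_derivative[OF smooth_inv_chart z] by (auto simp: differentiable_def)
qed

lemma inv_chart_inverse:
  assumes "t \<in> I" shows "inv_chart (dil (E t) x, \<tau> t) = (x, t)"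
  using assms by (simp add: inv_chart_def \<sigma>_\<tau> E_pos)

lemma chart_inv_chart:
  assumes "s \<in> J" "inv_chart (y, s) = (x, t)"
  shows "dil (E t) x = y" "\<tau> t = s" "t \<in> I"
  using assms by (auto simp: inv_chart_def \<tau>_\<sigma> \<sigma>_in E_pos)

text \<open>Preimages of Lebesgue measurable sets under a continuous map need not be measurable; here they
  are images under the differentiable inverse chart, which maps null sets to null sets.\<close>

lemma measurable_pullback:
  assumes f: "f \<in> borel_measurable (lebesgue_on (UNIV \<times> J))" and c: "continuous_on I c"
  shows "pullback c f \<in> borel_measurable (lebesgue_on (UNIV \<times> I))"
proof -
  let ?g = "\<lambda>z. f (dil (E (snd z)) (fst z), \<tau> (snd z))"
  have "?g \<in> borel_measurable (lebesgue_on (UNIV \<times> I))"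
  proof (rule measurableI)
    fix B :: "real set" assume B: "B \<in> sets borel"
    let ?A = "f -` B \<inter> (UNIV \<times> J)"
    have "?A \<in> sets (lebesgue_on (UNIV \<times> J))"
      using measurable_sets[OF f B] by simp
    then have A: "?A \<in> sets lebesgue"
      by (auto simp: sets_restrict_space_iff[of "UNIV \<times> J"] J_lebesgue)
    have "inv_chart ` ?A \<in> sets lebesgue"
      by (rule differentiable_image_in_sets_lebesgue[OF A order_refl])
         (rule differentiable_on_subset[OF differentiable_inv_chart], simp)
    moreover have "inv_chart ` ?A = ?g -` B \<inter> (UNIV \<times> I)"
    proof (intro equalityI subsetI)
      fix z assume "z \<in> inv_chart ` ?A"
      then obtain y s where ys: "f (y, s) \<in> B" "s \<in> J" "z = inv_chart (y, s)" by auto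
      then show "z \<in> ?g -` B \<inter> (UNIV \<times> I)"
        using chart_inv_chart[OF ys(2), of y "fst z" "snd z"] by (simp add: mem_Times_iff)
    next
      fix z assume z: "z \<in> ?g -` B \<inter> (UNIV \<times> I)"
      then have "z = inv_chart (dil (E (snd z)) (fst z), \<tau> (snd z))"
        using inv_chart_inverse[of "snd z" "fst z"] by auto
      moreover have "(dil (E (snd z)) (fst z), \<tau> (snd z)) \<in> ?A" using z \<tau>_in by auto
      ultimately show "z \<in> inv_chart ` ?A" by (rule image_eqI)
    qed
    ultimately show "?g -` B \<inter> space (lebesgue_on (UNIV \<times> I)) \<in> sets (lebesgue_on (UNIV \<times> I))"
      by (simp add: sets_restrict_space_iff[of "UNIV \<times> I"] I_lebesgue)
  qed simp
  moreover have "(\<lambda>z. c (snd z)) \<in> borel_measurable (lebesgue_on ((UNIV :: (real ^ 'n) set) \<times> I))"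
    by (intro continuous_imp_measurable_on_sets_lebesgue I_lebesgue
        continuous_on_compose2[OF c continuous_on_snd[OF continuous_on_id]]) auto
  ultimately have "(\<lambda>z. c (snd z) * ?g z) \<in> borel_measurable (lebesgue_on (UNIV \<times> I))"
    by (intro borel_measurable_times)
  then show ?thesis by (simp add: pullback_def case_prod_unfold)
qed

lemma AE_\<tau>:
  assumes "AE s in lebesgue_on J. P s" shows "AE t in lebesgue_on I. P (\<tau> t)"
proof -
  have "AE s in lebesgue. s \<in> J \<longrightarrow> P s"
    using assms by (simp add: AE_restrict_space_iff J_lebesgue)
  then obtain N where N: "N \<in> null_sets lebesgue" "{s. \<not> (s \<in> J \<longrightarrow> P s)} \<subseteq> N"
    by (auto simp: eventually_ae_filter)
  have "\<sigma> differentiable_on J"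
    by (rule differentiable_at_imp_differentiable_on)
       (unfold differentiable_def, rule exI, erule smooth_on_imp_has_derivative[OF smooth_\<sigma>])
  then have "negligible (\<sigma> ` (N \<inter> J))"
    using N(1) by (intro negligible_differentiable_image_negligible)
       (auto simp: negligible_iff_null_sets[symmetric] intro: negligible_subset differentiable_on_subset)
  moreover have "{t. \<not> (t \<in> I \<longrightarrow> P (\<tau> t))} \<subseteq> \<sigma> ` (N \<inter> J)"
  proof
    fix t assume "t \<in> {t. \<not> (t \<in> I \<longrightarrow> P (\<tau> t))}"
    then have t: "t \<in> I" "\<not> P (\<tau> t)" by auto
    then have "\<tau> t \<in> N \<inter> J" using N(2) \<tau>_in by auto
    then show "t \<in> \<sigma> ` (N \<inter> J)" by (rule image_eqI[rotated]) (simp add: \<sigma>_\<tau> t)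
  qed
  ultimately have "AE t in lebesgue. t \<in> I \<longrightarrow> P (\<tau> t)"
    unfolding eventually_ae_filter negligible_iff_null_sets by auto
  then show ?thesis by (simp add: AE_restrict_space_iff I_lebesgue)
qed

text \<open>A compact set that moves with time stays, over a compact time interval, within one compact
  set. This compensates for the space-time cylinders in the definitions not being preserved by the
  chart.\<close>

lemma compact_swept_image:
  assumes "compact K" "compact J0" "J0 \<subseteq> I"
  obtains L where "compact L" "\<And>t. t \<in> J0 \<Longrightarrow> dil (E t) ` K \<subseteq> L"
proof
  have "continuous_on (K \<times> J0) (\<lambda>z. dil (E (snd z)) (fst z))"
    unfolding dil_def
    by (intro continuous_on_vec_lambda continuous_on_mult continuous_on_component
        continuous_on_fst continuous_on_id continuous_on_compose2[OF cont_E continuous_on_snd[OF continuous_on_id]])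
       (use assms(3) in auto)
  then show "compact ((\<lambda>z. dil (E (snd z)) (fst z)) ` (K \<times> J0))"
    by (rule compact_continuous_image) (intro compact_Times assms)
  show "dil (E t) ` K \<subseteq> (\<lambda>z. dil (E (snd z)) (fst z)) ` (K \<times> J0)" if "t \<in> J0" for t
    using that by force
qed

section \<open>Local function spaces under a coordinate change\<close>

text \<open>The first part makes the second hold for arbitrary \<open>h\<close>: either both integrals exist or both
  have the default value 0.\<close>

lemma integral_\<tau>:
  assumes S: "S \<subseteq> I" "S \<in> sets lebesgue"
  shows "set_integrable lebesgue S (\<lambda>t. \<tau>' t * h (\<tau> t)) \<longleftrightarrow> set_integrable lebesgue (\<tau> ` S) h"
    and "(LINT t:S|lebesgue. \<tau>' t * h (\<tau> t)) = (LINT s:\<tau> ` S|lebesgue. h s)"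
proof -
  have abs: "\<bar>\<tau>' t\<bar> * h (\<tau> t) = \<tau>' t * h (\<tau> t)" if "t \<in> S" for t
    using \<tau>'_pos[of t] S(1) that by auto
  have der: "(\<tau> has_field_derivative \<tau>' t) (at t within S)" if "t \<in> S" for t
    using \<tau>_deriv[of t] S(1) that by (auto intro: has_field_derivative_at_within)
  note cov = has_absolute_integral_change_of_variables_1'[OF S(2) der inj_on_subset[OF inj_\<tau> S(1)], of h]
  have cong: "set_integrable lebesgue S (\<lambda>t. \<bar>\<tau>' t\<bar> * h (\<tau> t)) \<longleftrightarrow>
      set_integrable lebesgue S (\<lambda>t. \<tau>' t * h (\<tau> t))"
    by (rule set_integrable_cong) (simp_all add: abs)
  show iff: "set_integrable lebesgue S (\<lambda>t. \<tau>' t * h (\<tau> t)) \<longleftrightarrow> set_integrable lebesgue (\<tau> ` S) h"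
    using cov cong by blast
  show "(LINT t:S|lebesgue. \<tau>' t * h (\<tau> t)) = (LINT s:\<tau> ` S|lebesgue. h s)"
  proof (cases "set_integrable lebesgue (\<tau> ` S) h")
    case True
    then have "integral S (\<lambda>t. \<bar>\<tau>' t\<bar> * h (\<tau> t)) = integral (\<tau> ` S) h"
      using cov[of "integral (\<tau> ` S) h"] by blast
    moreover have "integral S (\<lambda>t. \<bar>\<tau>' t\<bar> * h (\<tau> t)) = integral S (\<lambda>t. \<tau>' t * h (\<tau> t))"
      by (rule Henstock_Kurzweil_Integration.integral_cong) (rule abs)
    ultimately show ?thesis
      using set_lebesgue_integral_eq_integral(2)[OF True]
        set_lebesgue_integral_eq_integral(2)[OF iff[THEN iffD2, OF True]] by simp
  next
    case False
    then show ?thesis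
      using iff by (simp add: set_integrable_def set_lebesgue_integral_def not_integrable_integral_eq)
  qed
qed

text \<open>The region of integration \<open>dil (E t) ` K\<close> of the slices varies with \<open>t\<close>. For the size of the
  integral it is enlarged to a fixed compact set \<open>L\<close>; its measurability in \<open>t\<close> does not follow in
  this way and rests on Tonelli's theorem.\<close>

lemma Lq_loc_Lq_loc_pullback:
  assumes f: "Lq_loc_Lq_loc q J UNIV f" and c: "continuous_on I c" "\<And>t. t \<in> I \<Longrightarrow> 0 < c t"
  shows "Lq_loc_Lq_loc q I UNIV (pullback c f)"
  unfolding Lq_loc_Lq_loc_def
proof (intro conjI allI impI)
  show meas: "pullback c f \<in> borel_measurable (lebesgue_on (UNIV \<times> I))"
    using f c(1) by (intro measurable_pullback) (simp_all add: Lq_loc_Lq_loc_def)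
  have slices_f: "AE t in lebesgue_on I. Lq_loc q UNIV (\<lambda>y. f (y, \<tau> t))"
    using f by (intro AE_\<tau>) (simp add: Lq_loc_Lq_loc_def)
  have AE_I: "AE t in lebesgue_on I. t \<in> I"
    by (rule AE_I2) simp
  show slices: "AE t in lebesgue_on I. Lq_loc q UNIV (\<lambda>x. pullback c f (x, t))"
    using slices_f AE_I
  proof eventually_elim
    case (elim t)
    show ?case using Lq_loc_dil[OF E_pos[OF elim(2)] elim(1), of "c t"] by simp
  qed
  fix J0 :: "real set" and K :: "(real ^ 'n) set"
  assume "compact J0 \<and> J0 \<subseteq> I \<and> compact K \<and> K \<subseteq> UNIV"
  then have J0: "compact J0" "J0 \<subseteq> I" and K: "compact K" by auto
  have J0s [measurable]: "J0 \<in> sets lebesgue" and Ks [measurable]: "K \<in> sets lebesgue"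
    using compact_in_sets_lebesgue J0(1) K by auto
  obtain L where L: "compact L" "\<And>t. t \<in> J0 \<Longrightarrow> dil (E t) ` K \<subseteq> L"
    using compact_swept_image[OF K J0] by blast
  define R where "R = (\<lambda>s. LINT y:L|lebesgue. \<bar>f (y, s)\<bar> powr q)"
  define F where "F = (\<lambda>t. LINT x:K|lebesgue. \<bar>pullback c f (x, t)\<bar> powr q)"
  have J1: "compact (\<tau> ` J0)" "\<tau> ` J0 \<subseteq> J"
    using J0 \<tau>_in continuous_on_subset[OF cont_\<tau>] by (auto intro!: compact_continuous_image)
  have "set_integrable lebesgue (\<tau> ` J0) R"
    using f J1 L(1) by (simp add: Lq_loc_Lq_loc_def R_def)
  then have int: "set_integrable lebesgue J0 (\<lambda>t. \<tau>' t * R (\<tau> t))"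
    by (simp add: integral_\<tau>(1)[OF J0(2) J0s])
  let ?k = "\<lambda>t. c t powr q / (jac t * \<tau>' t)"
  have "continuous_on J0 ?k"
    using jac_pos \<tau>'_pos c(2) J0(2)
    by (intro continuous_on_divide continuous_on_powr continuous_on_mult continuous_on_const
        continuous_on_subset[OF c(1)] continuous_on_subset[OF cont_jac] continuous_on_subset[OF \<tau>'_cont])
       (force simp del: prod_zero_iff)+
  then have "bounded (?k ` J0)"
    by (rule compact_imp_bounded[OF compact_continuous_image[OF _ J0(1)]])
  then obtain C where C': "\<forall>y\<in>?k ` J0. norm y \<le> C" by (auto simp: bounded_iff)
  have C: "?k t \<le> C" if "t \<in> J0" for t
    using C'[THEN bspec, OF imageI[OF that]] unfolding real_norm_def
    by (rule order_trans[OF abs_ge_self])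
  have R_nonneg: "0 \<le> R s" for s by (simp add: R_def set_lebesgue_integral_def)
  have bound: "\<bar>F t\<bar> \<le> C * (\<tau>' t * R (\<tau> t))" if t: "t \<in> J0" "Lq_loc q UNIV (\<lambda>y. f (y, \<tau> t))" for t
  proof -
    have tI: "t \<in> I" using t(1) J0(2) by auto
    note pos = jac_pos[OF tI] \<tau>'_pos[OF tI] c(2)[OF tI]
    have "F t = c t powr q * (LINT x:K|lebesgue. \<bar>f (dil (E t) x, \<tau> t)\<bar> powr q)"
      using pos(3) by (simp add: F_def abs_mult powr_mult)
    also have "\<dots> \<le> c t powr q * (R (\<tau> t) / jac t)"
      unfolding R_def
    proof (intro mult_left_mono set_integral_dil_le(2)[where f="\<lambda>y. \<bar>f (y, \<tau> t)\<bar> powr q"])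
      show "set_integrable lebesgue L (\<lambda>x. \<bar>f (x, \<tau> t)\<bar> powr q)"
        using t(2) L(1) by (simp add: Lq_loc_def)
    qed (use E_pos[OF tI] L(2)[OF t(1)] Ks in auto)
    also have "\<dots> = ?k t * (\<tau>' t * R (\<tau> t))"
      using pos by (simp add: field_simps del: prod_zero_iff)
    also have "\<dots> \<le> C * (\<tau>' t * R (\<tau> t))"
      using C[OF t(1)] pos R_nonneg by (intro mult_right_mono) auto
    finally have "F t \<le> C * (\<tau>' t * R (\<tau> t))" .
    moreover have "0 \<le> F t" by (simp add: F_def set_lebesgue_integral_def)
    ultimately show ?thesis by simp
  qed
  have F_meas: "set_borel_measurable lebesgue J0 F"
  proof -
    define H where "H = (\<lambda>z. if z \<in> UNIV \<times> I then indicator K (fst z) * \<bar>pullback c f z\<bar> powr q else 0)"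
    have "(\<lambda>z. indicator K (fst z) * \<bar>pullback c f z\<bar> powr q :: real) \<in> borel_measurable (lebesgue_on (UNIV \<times> I))"
    proof (intro borel_measurable_times powr_real_measurable borel_measurable_abs meas borel_measurable_const)
      have "(indicator (K \<times> UNIV) :: _ \<Rightarrow> real) \<in> borel_measurable (lebesgue :: ((real ^ 'n) \<times> real) measure)"
        using compact_imp_closed[OF K] by (intro borel_measurable_indicator) (simp add: borel_closed closed_Times)
      moreover have "(indicator (K \<times> UNIV) :: (real ^ 'n) \<times> real \<Rightarrow> real) = (\<lambda>z. indicator K (fst z))"
        by (auto simp: fun_eq_iff indicator_def)
      ultimately show "(\<lambda>z. indicator K (fst z) :: real) \<in> borel_measurable (lebesgue_on (UNIV \<times> I))"
        by (intro measurable_restrict_space1) simp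
    qed
    then have H: "H \<in> borel_measurable lebesgue"
      unfolding H_def by (rule borel_measurable_if_I) (rule I_lebesgue)
    have "AE t in lebesgue. t \<in> I \<longrightarrow> Lq_loc q UNIV (\<lambda>x. pullback c f (x, t))"
      using slices by (simp add: AE_restrict_space_iff I_lebesgue)
    then have "AE t in lebesgue. (\<lambda>x. H (x, t)) \<in> borel_measurable lebesgue"
    proof eventually_elim
      case (elim t)
      show ?case
      proof (cases "t \<in> I")
        case True
        then have [measurable]: "(\<lambda>x. pullback c f (x, t)) \<in> borel_measurable lebesgue"
          using elim by (simp only: Lq_loc_def lebesgue_on_UNIV_eq)
        have "(\<lambda>x. indicator K x * \<bar>pullback c f (x, t)\<bar> powr q :: real) \<in> borel_measurable lebesgue"
          by measurable
        then show ?thesis using True by (simp add: H_def)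
      qed (simp add: H_def)
    qed
    from measurable_integral_slices[OF H this]
    have "(\<lambda>t. indicator J0 t * (LINT x|lebesgue. H (x, t))) \<in> borel_measurable lebesgue"
      by measurable
    moreover have "indicator J0 t * (LINT x|lebesgue. H (x, t)) = indicator J0 t *\<^sub>R F t" for t
      using J0(2) by (auto simp: indicator_def H_def F_def set_lebesgue_integral_def)
    ultimately show ?thesis by (simp add: set_borel_measurable_def)
  qed
  have "set_integrable lebesgue J0 F"
  proof (rule set_integrable_bound)
    show "set_integrable lebesgue J0 (\<lambda>t. C * (\<tau>' t * R (\<tau> t)))"
      by (intro set_integrable_mult_right int)
    have "AE t in lebesgue. t \<in> I \<longrightarrow> Lq_loc q UNIV (\<lambda>y. f (y, \<tau> t))"
      using slices_f by (simp add: AE_restrict_space_iff I_lebesgue)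
    then show "AE t in lebesgue. t \<in> J0 \<longrightarrow> norm (F t) \<le> norm (C * (\<tau>' t * R (\<tau> t)))"
    proof eventually_elim
      case (elim t)
      show ?case
      proof
        assume "t \<in> J0"
        then have "\<bar>F t\<bar> \<le> C * (\<tau>' t * R (\<tau> t))" using bound elim J0(2) by blast
        then show "norm (F t) \<le> norm (C * (\<tau>' t * R (\<tau> t)))"
          unfolding real_norm_def by (rule order_trans[OF _ abs_ge_self])
      qed
    qed
  qed (rule F_meas)
  then show "set_integrable lebesgue J0 (\<lambda>t. LINT x:K|lebesgue. \<bar>pullback c f (x, t)\<bar> powr q)"
    by (simp add: F_def)
qed

lemma L1_loc_W11_loc_pullback:
  assumes "L1_loc_W11_loc J UNIV u G"
  shows "L1_loc_W11_loc I UNIV (pullback jac u) (\<lambda>i. pullback (\<lambda>t. jac t * E t i) (G i))"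
proof -
  have "AE s in lebesgue_on J. W11_loc UNIV (\<lambda>x. u (x, s)) (\<lambda>i x. G i (x, s))"
    using assms by (simp add: L1_loc_W11_loc_def)
  from AE_\<tau>[OF this] have "AE t in lebesgue_on I. W11_loc UNIV (\<lambda>x. u (x, \<tau> t)) (\<lambda>i x. G i (x, \<tau> t))" .
  moreover have "AE t in lebesgue_on I. t \<in> I"
    by (rule AE_I2) simp
  ultimately have "AE t in lebesgue_on I. W11_loc UNIV (\<lambda>x. pullback jac u (x, t))
      (\<lambda>i x. pullback (\<lambda>t. jac t * E t i) (G i) (x, t))"
  proof eventually_elim
    case (elim t)
    show ?case
      using W11_loc_dil[OF E_pos[OF elim(2)] elim(1), of "jac t"] by simp
  qed
  then show ?thesis
    unfolding L1_loc_W11_loc_def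
    using assms
    by (intro conjI allI Lq_loc_Lq_loc_pullback cont_jac continuous_on_mult cont_E jac_pos mult_pos_pos E_pos)
       (simp_all add: L1_loc_W11_loc_def)
qed

text \<open>The difference of two time slices splits into one of slices of \<open>u\<close> along a common dilation,
  which is small by hypothesis, and one of two dilations of the same slice.\<close>

lemma C0_L2_loc_pullback:
  assumes u: "C0_L2_loc J UNIV u"
  shows "C0_L2_loc I UNIV (pullback jac u)"
  unfolding C0_L2_loc_def
proof (intro conjI ballI allI impI)
  have slice: "Lq_loc 2 UNIV (\<lambda>y. u (y, \<tau> t))" if "t \<in> I" for t
    using u \<tau>_in[OF that] by (simp add: C0_L2_loc_def)
  have slice_dil: "Lq_loc 2 UNIV (\<lambda>x. c * u (dil (E r) x, \<tau> t))" if "t \<in> I" "r \<in> I" for t r c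
    by (rule Lq_loc_dil[OF E_pos[OF that(2)] slice[OF that(1)]])
  show "Lq_loc 2 UNIV (\<lambda>x. pullback jac u (x, t))" if "t \<in> I" for t
    using slice_dil[OF that that] by simp
  fix K :: "(real ^ 'n) set" and t0 assume "compact K \<and> K \<subseteq> UNIV" and t0: "t0 \<in> I"
  then have K: "compact K" by simp
  note Ks = compact_in_sets_lebesgue[OF K]
  show "((\<lambda>t. LINT x:K|lebesgue. (pullback jac u (x, t) - pullback jac u (x, t0))\<^sup>2) \<longlongrightarrow> 0) (at t0 within I)"
    unfolding tendsto_at_iff_sequentially comp_def
  proof (intro allI impI)
    fix X assume XI: "\<forall>i. X i \<in> I - {t0}" and X: "X \<longlonglongrightarrow> t0"
    have XI': "X n \<in> I" for n using XI by auto
    have lim: "(\<lambda>n. g (X n)) \<longlonglongrightarrow> g t0" if "continuous_on I g" for g :: "real \<Rightarrow> real"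
      using continuous_on_tendsto_compose[OF that X t0] XI' by simp
    have J0: "compact (insert t0 (range X))" "insert t0 (range X) \<subseteq> I"
      using compact_sequence_with_limit[OF X] XI' t0 by auto
    obtain L where L: "compact L" "\<And>t. t \<in> insert t0 (range X) \<Longrightarrow> dil (E t) ` K \<subseteq> L"
      using compact_swept_image[OF K J0] by blast
    define d where "d = (\<lambda>n. LINT y:L|lebesgue. (u (y, \<tau> (X n)) - u (y, \<tau> t0))\<^sup>2)"
    define a where "a = (\<lambda>n x. jac (X n) * u (dil (E (X n)) x, \<tau> (X n)) - jac (X n) * u (dil (E (X n)) x, \<tau> t0))"
    define b where "b = (\<lambda>n x. jac (X n) * u (dil (E (X n)) x, \<tau> t0) - jac t0 * u (dil (E t0) x, \<tau> t0))"
    have d0: "d \<longlonglongrightarrow> 0"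
    proof -
      have "((\<lambda>s. LINT y:L|lebesgue. (u (y, s) - u (y, \<tau> t0))\<^sup>2) \<longlongrightarrow> 0) (at (\<tau> t0) within J)"
        using u L(1) \<tau>_in[OF t0] by (simp add: C0_L2_loc_def)
      note * = this[unfolded tendsto_at_iff_sequentially comp_def, rule_format, of "\<lambda>n. \<tau> (X n)"]
      have "\<tau> (X n) \<in> J - {\<tau> t0}" for n
        using XI \<tau>_in inj_onD[OF inj_\<tau> _ _ t0] by blast
      then show ?thesis
        unfolding d_def by (rule *) (rule lim[OF cont_\<tau>])
    qed
    have diff: "set_integrable lebesgue S (\<lambda>x. (f x - g x)\<^sup>2)"
      if "Lq_loc 2 UNIV f" "Lq_loc 2 UNIV g" "compact S" for f g :: "real ^ 'n \<Rightarrow> real" and S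
    proof -
      have "Lq_loc 2 UNIV (\<lambda>x. - 1 * g (dil (\<lambda>_. 1) x))"
        by (rule Lq_loc_dil[OF _ that(2)]) simp
      moreover have "dil (\<lambda>_. 1) x = x" for x :: "real ^ 'n" by (simp add: vec_eq_iff)
      ultimately have g: "Lq_loc 2 UNIV (\<lambda>x. - g x)" by simp
      have "set_integrable lebesgue S (\<lambda>x. (f x + - g x)\<^sup>2)"
        by (intro set_integrable_sq_add(1) Lq_loc_2_D[OF that(1)] Lq_loc_2_D[OF g] that(3)
            compact_in_sets_lebesgue)
      then show ?thesis by simp
    qed
    have ai: "set_integrable lebesgue K (\<lambda>x. (a n x)\<^sup>2)" and bi: "set_integrable lebesgue K (\<lambda>x. (b n x)\<^sup>2)" for n
      unfolding a_def b_def by (intro diff slice_dil K XI' t0)+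
    have meas: "a n \<in> borel_measurable lebesgue" "b n \<in> borel_measurable lebesgue" for n
      unfolding a_def b_def
      by (intro borel_measurable_diff Lq_loc_2_D(1) slice_dil XI' t0)+
    have a_le: "(LINT x:K|lebesgue. (a n x)\<^sup>2) \<le> jac (X n) * d n" for n
    proof -
      have pos: "0 < jac (X n)" by (rule jac_pos[OF XI'])
      have "(LINT x:K|lebesgue. (a n x)\<^sup>2) =
          (jac (X n))\<^sup>2 * (LINT x:K|lebesgue. (u (dil (E (X n)) x, \<tau> (X n)) - u (dil (E (X n)) x, \<tau> t0))\<^sup>2)"
        unfolding a_def right_diff_distrib[symmetric] power_mult_distrib by simp
      also have "\<dots> \<le> (jac (X n))\<^sup>2 * (d n / jac (X n))"
        unfolding d_def
      proof (intro mult_left_mono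
          set_integral_dil_le(2)[where f="\<lambda>y. (u (y, \<tau> (X n)) - u (y, \<tau> t0))\<^sup>2"])
        show "set_integrable lebesgue L (\<lambda>y. (u (y, \<tau> (X n)) - u (y, \<tau> t0))\<^sup>2)"
          by (intro diff slice XI' t0 L(1))
      qed (use E_pos[OF XI'] L(2) Ks in auto)
      also have "\<dots> = jac (X n) * d n"
        using pos by (simp add: power2_eq_square del: prod_zero_iff)
      finally show ?thesis .
    qed
    have "(\<lambda>n. LINT x:K|lebesgue. (b n x)\<^sup>2) \<longlonglongrightarrow> 0"
      unfolding b_def
      by (rule dil_continuous_L2[OF slice[OF t0] K])
         (auto intro: E_pos XI' t0 lim cont_E cont_jac)
    then have "(\<lambda>n. 2 * (jac (X n) * d n) + 2 * (LINT x:K|lebesgue. (b n x)\<^sup>2)) \<longlonglongrightarrow>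
        2 * (jac t0 * 0) + 2 * 0"
      by (intro tendsto_add tendsto_mult tendsto_const d0 lim[OF cont_jac])
    then have upper: "(\<lambda>n. 2 * (jac (X n) * d n) + 2 * (LINT x:K|lebesgue. (b n x)\<^sup>2)) \<longlonglongrightarrow> 0"
      by simp
    show "(\<lambda>n. LINT x:K|lebesgue. (pullback jac u (x, X n) - pullback jac u (x, t0))\<^sup>2) \<longlonglongrightarrow> 0"
    proof (rule tendsto_sandwich[OF _ _ tendsto_const upper])
      show "\<forall>\<^sub>F n in sequentially. 0 \<le> (LINT x:K|lebesgue. (pullback jac u (x, X n) - pullback jac u (x, t0))\<^sup>2)"
        by (simp add: set_lebesgue_integral_def)
      show "\<forall>\<^sub>F n in sequentially. (LINT x:K|lebesgue. (pullback jac u (x, X n) - pullback jac u (x, t0))\<^sup>2)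
          \<le> 2 * (jac (X n) * d n) + 2 * (LINT x:K|lebesgue. (b n x)\<^sup>2)"
      proof (intro always_eventually allI)
        fix n
        have "(LINT x:K|lebesgue. (pullback jac u (x, X n) - pullback jac u (x, t0))\<^sup>2) =
            (LINT x:K|lebesgue. (a n x + b n x)\<^sup>2)"
          by (simp add: a_def b_def)
        also have "\<dots> \<le> 2 * (LINT x:K|lebesgue. (a n x)\<^sup>2) + 2 * (LINT x:K|lebesgue. (b n x)\<^sup>2)"
          by (rule set_integrable_sq_add(2)[OF ai bi meas Ks])
        also have "\<dots> \<le> 2 * (jac (X n) * d n) + 2 * (LINT x:K|lebesgue. (b n x)\<^sup>2)"
          by (intro add_mono mult_left_mono a_le order_refl) simp
        finally show "(LINT x:K|lebesgue. (pullback jac u (x, X n) - pullback jac u (x, t0))\<^sup>2)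
          \<le> 2 * (jac (X n) * d n) + 2 * (LINT x:K|lebesgue. (b n x)\<^sup>2)" .
      qed
    qed
  qed
qed

section \<open>Local weak solutions under a coordinate change\<close>

lemma image_\<tau>_interval:
  assumes "t1 \<in> I" "t2 \<in> I" "t1 < t2" shows "\<tau> ` {t1..t2} = {\<tau> t1..\<tau> t2}"
proof -
  have sub: "{t1..t2} \<subseteq> I" "{\<tau> t1..\<tau> t2} \<subseteq> J"
    using mem_is_interval_1_I[OF interval_I assms(1,2)]
      mem_is_interval_1_I[OF interval_J \<tau>_in[OF assms(1)] \<tau>_in[OF assms(2)]] by auto
  have mono: "\<tau> s \<le> \<tau> t \<longleftrightarrow> s \<le> t" if "s \<in> I" "t \<in> I" for s t
    using \<tau>_strict_mono[OF that] \<tau>_strict_mono[OF that(2,1)]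
    by (cases s t rule: linorder_cases) auto
  show ?thesis
  proof (intro equalityI subsetI)
    fix s assume "s \<in> \<tau> ` {t1..t2}"
    then show "s \<in> {\<tau> t1..\<tau> t2}" using mono sub assms by auto
  next
    fix s assume s: "s \<in> {\<tau> t1..\<tau> t2}"
    then have "s \<in> J" using sub by auto
    note \<sigma>s = \<sigma>_in[OF this] \<tau>_\<sigma>[OF this]
    have "\<sigma> s \<in> {t1..t2}" using s mono[of t1 "\<sigma> s"] mono[of "\<sigma> s" t2] \<sigma>s assms by auto
    then show "s \<in> \<tau> ` {t1..t2}" by (rule image_eqI[rotated]) (simp add: \<sigma>s)
  qed
qed

lemma has_derivative_chart:
  assumes t: "t \<in> I"
  shows "((\<lambda>z. (dil (E (snd z)) (fst z), \<tau> (snd z))) has_derivative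
    (\<lambda>v. ((\<chi> i. E t i * fst v $ i + E' t i * snd v * x $ i), \<tau>' t * snd v))) (at (x, t))"
proof (rule has_derivative_Pair)
  have E: "((\<lambda>t. E t i) has_derivative (*) (E' t i)) (at t)" for i
    using E_deriv[OF t] by (simp add: has_field_derivative_def)
  have ES: "((\<lambda>z. E (snd z) i) has_derivative (\<lambda>v. E' t i * snd v)) (at (x, t))" for i
    by (rule has_derivative_compose[OF has_derivative_snd[OF has_derivative_ident]]) (simp add: E)
  show "((\<lambda>z. dil (E (snd z)) (fst z)) has_derivative
      (\<lambda>v. \<chi> i. E t i * fst v $ i + E' t i * snd v * x $ i)) (at (x, t))"
  proof (subst has_derivative_componentwise_within, intro ballI)
    fix b :: "real ^ 'n" assume "b \<in> Basis"
    then obtain i where b: "b = axis i 1" by (auto simp: Basis_vec_def)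
    have "((\<lambda>z. E (snd z) i * fst z $ i) has_derivative
        (\<lambda>v. E (snd (x, t)) i * (fst v $ i) + (E' t i * snd v) * (fst (x, t) $ i))) (at (x, t))"
      by (intro has_derivative_mult ES bounded_linear_imp_has_derivative
          bounded_linear_compose[OF bounded_linear_vec_nth bounded_linear_fst])
    then show "((\<lambda>z. dil (E (snd z)) (fst z) \<bullet> b) has_derivative
        (\<lambda>v. (\<chi> i. E t i * fst v $ i + E' t i * snd v * x $ i) \<bullet> b)) (at (x, t))"
      by (simp add: b inner_axis)
  qed
  have "(\<tau> has_derivative (*) (\<tau>' t)) (at t)"
    using \<tau>_deriv[OF t] by (simp add: has_field_derivative_def)
  then show "((\<lambda>z. \<tau> (snd z)) has_derivative (\<lambda>v. \<tau>' t * snd v)) (at (x, t))"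
    by (intro has_derivative_compose[OF has_derivative_snd[OF has_derivative_ident]]) simp
qed

text \<open>The relation between \<open>\<phi>\<close> and \<open>\<psi>\<close> is assumed for times in \<open>T\<close> only, because the \<open>\<psi>\<close> to
  which this is applied is cut off in time. The sum in the second formula comes from the motion of
  the dilation and turns into the drift term of the transformed equation.\<close>

lemma frechet_derivative_chart:
  fixes x :: "real ^ 'n"
  assumes t: "t \<in> T" and T: "open T" "T \<subseteq> I"
    and \<phi>: "\<And>x r. r \<in> T \<Longrightarrow> \<phi> (x, r) = \<psi> (dil (E r) x, \<tau> r)"
    and \<psi>: "smooth_on (UNIV \<times> J) \<psi>"
  defines "D \<equiv> frechet_derivative \<psi> (at (dil (E t) x, \<tau> t))"
  shows "frechet_derivative \<phi> (at (x, t)) (axis i 1, 0) = E t i * D (axis i 1, 0)"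
    and "frechet_derivative \<phi> (at (x, t)) (0, 1) =
      (\<Sum>i\<in>UNIV. E' t i * x $ i * D (axis i 1, 0)) + \<tau>' t * D (0, 1)"
proof -
  have tI: "t \<in> I" using t T by auto
  have D: "(\<psi> has_derivative D) (at (dil (E t) x, \<tau> t))"
    unfolding D_def by (rule smooth_on_imp_has_derivative[OF \<psi>]) (simp add: \<tau>_in tI)
  note lin = has_derivative_linear[OF D]
  let ?c = "\<lambda>v. ((\<chi> i. E t i * fst v $ i + E' t i * snd v * x $ i), \<tau>' t * snd v)"
  have "((\<lambda>z. \<psi> (dil (E (snd z)) (fst z), \<tau> (snd z))) has_derivative (\<lambda>v. D (?c v))) (at (x, t))"
    by (rule has_derivative_compose[OF has_derivative_chart[OF tI]]) (simp add: D)
  then have "(\<phi> has_derivative (\<lambda>v. D (?c v))) (at (x, t))"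
  proof (rule has_derivative_transform_within_open[where s="UNIV \<times> T"])
    show "\<psi> (dil (E (snd z)) (fst z), \<tau> (snd z)) = \<phi> z" if "z \<in> UNIV \<times> T" for z
      using \<phi>[of "snd z" "fst z"] that by auto
  qed (use t T in \<open>auto intro: open_Times\<close>)
  then have eq: "frechet_derivative \<phi> (at (x, t)) = (\<lambda>v. D (?c v))"
    by (rule frechet_derivative_at[symmetric])
  have "?c (axis i 1, 0) = E t i *\<^sub>R (axis i 1, 0)"
    by (simp add: vec_eq_iff axis_def)
  then show "frechet_derivative \<phi> (at (x, t)) (axis i 1, 0) = E t i * D (axis i 1, 0)"
    by (simp only: eq linear_scale[OF lin]) simp
  have "?c (0, 1) = (\<Sum>i\<in>UNIV. (E' t i * x $ i) *\<^sub>R (axis i 1, 0)) + \<tau>' t *\<^sub>R (0, 1)"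
    by (simp add: prod_eq_iff fst_sum snd_sum vec_eq_iff axis_def if_distrib cong: if_cong)
  then show "frechet_derivative \<phi> (at (x, t)) (0, 1) =
      (\<Sum>i\<in>UNIV. E' t i * x $ i * D (axis i 1, 0)) + \<tau>' t * D (0, 1)"
    by (simp only: eq linear_add[OF lin] linear_sum[OF lin] linear_scale[OF lin]) simp
qed

text \<open>A test function is transported by the inverse chart. Its support then moves with time and
  need not stay in one compact set for all times; multiplication by a cutoff in time repairs this
  without affecting the times between \<open>t1\<close> and \<open>t2\<close>.\<close>

lemma transported_test_function:
  assumes t12: "t1 \<in> I" "t2 \<in> I" "t1 < t2" and K: "compact K"
    and \<phi>: "smooth_on (UNIV \<times> I) \<phi>" "\<And>t x. t \<in> I \<Longrightarrow> x \<notin> K \<Longrightarrow> \<phi> (x, t) = 0"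
  obtains \<psi> L T where "smooth_on (UNIV \<times> J) \<psi>" "compact L"
    "\<And>s y. s \<in> J \<Longrightarrow> y \<notin> L \<Longrightarrow> \<psi> (y, s) = 0"
    "open T" "T \<subseteq> I" "{t1..t2} \<subseteq> T" "\<And>x t. t \<in> T \<Longrightarrow> \<phi> (x, t) = \<psi> (dil (E t) x, \<tau> t)"
proof -
  let ?s1 = "\<tau> t1" and ?s2 = "\<tau> t2"
  have s12: "?s1 \<in> J" "?s2 \<in> J" "?s1 < ?s2" using t12 \<tau>_in \<tau>_strict_mono by auto
  obtain \<delta>1 \<delta>2 where \<delta>12: "\<delta>1 > 0" "cball ?s1 \<delta>1 \<subseteq> J" "\<delta>2 > 0" "cball ?s2 \<delta>2 \<subseteq> J"
    using open_J s12 by (meson open_contains_cball)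
  define \<delta> where "\<delta> = min \<delta>1 \<delta>2"
  have "\<delta> > 0" using \<delta>12 by (simp add: \<delta>_def)
  moreover have "?s1 - \<delta> \<in> J"
    by (rule subsetD[OF \<delta>12(2)]) (use \<delta>12 in \<open>simp add: \<delta>_def dist_real_def\<close>)
  moreover have "?s2 + \<delta> \<in> J"
    by (rule subsetD[OF \<delta>12(4)]) (use \<delta>12 in \<open>simp add: \<delta>_def dist_real_def\<close>)
  ultimately have \<delta>: "\<delta> > 0" "?s1 - \<delta> \<in> J" "?s2 + \<delta> \<in> J" by auto
  have ad: "{?s1 - \<delta>..?s2 + \<delta>} \<subseteq> J"
    using mem_is_interval_1_I[OF interval_J \<delta>(2,3)] by auto
  obtain \<eta> where \<eta>: "smooth_on UNIV \<eta>" "\<And>s. s \<notin> {?s1 - \<delta>..?s2 + \<delta>} \<Longrightarrow> \<eta> s = 0"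
    "\<And>s. s \<in> {?s1 - \<delta> / 2..?s2 + \<delta> / 2} \<Longrightarrow> \<eta> s = 1"
    using smooth_cutoff[of "?s1 - \<delta>" "?s1 - \<delta> / 2" "?s2 + \<delta> / 2" "?s2 + \<delta>"] \<delta>(1) s12(3)
    by (auto simp: algebra_simps)
  define \<psi> where "\<psi> = (\<lambda>z. \<eta> (snd z) * \<phi> (inv_chart z))"
  have op: "open ((UNIV :: (real ^ 'n) set) \<times> J)" "open ((UNIV :: (real ^ 'n) set) \<times> I)"
    by (intro open_Times open_UNIV open_J open_I)+
  have im: "inv_chart ` (UNIV \<times> J) \<subseteq> UNIV \<times> I"
    using \<sigma>_in by (auto simp: inv_chart_def)
  have snd: "smooth_on (UNIV \<times> J) (\<lambda>z :: (real ^ 'n) \<times> real. snd z)"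
    by (rule smooth_on_bounded_linear[OF op(1) bounded_linear_snd])
  have smooth: "smooth_on (UNIV \<times> J) \<psi>"
    unfolding \<psi>_def
    by (rule smooth_on_mult[OF op(1)
          smooth_on_compose_real[OF op(1) open_UNIV subset_UNIV \<eta>(1) snd]
          smooth_on_compose[OF op im \<phi>(1) smooth_inv_chart]])
  have "continuous_on J \<sigma>"
    using smooth_\<sigma> unfolding smooth_on_def by (metis Ck_on.simps(1))
  then have "compact (\<sigma> ` {?s1 - \<delta>..?s2 + \<delta>})"
    by (intro compact_continuous_image continuous_on_subset[OF _ ad]) simp_all
  moreover have "\<sigma> ` {?s1 - \<delta>..?s2 + \<delta>} \<subseteq> I" using \<sigma>_in ad by auto
  ultimately obtain L where L: "compact L"
    "\<And>t. t \<in> \<sigma> ` {?s1 - \<delta>..?s2 + \<delta>} \<Longrightarrow> dil (E t) ` K \<subseteq> L"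
    using compact_swept_image[OF K] by blast
  have supp: "\<psi> (y, s) = 0" if "s \<in> J" "y \<notin> L" for y s
  proof (cases "s \<in> {?s1 - \<delta>..?s2 + \<delta>}")
    case True
    define x where "x = dil (\<lambda>i. 1 / E (\<sigma> s) i) y"
    have inv: "inv_chart (y, s) = (x, \<sigma> s)" by (simp add: x_def inv_chart_def)
    have "x \<notin> K"
      using L(2)[of "\<sigma> s"] True that chart_inv_chart(1)[OF that(1) inv] by blast
    then show ?thesis using \<phi>(2)[OF \<sigma>_in[OF that(1)]] by (simp add: \<psi>_def inv)
  qed (simp add: \<psi>_def \<eta>(2))
  define T where "T = I \<inter> \<tau> -` {?s1 - \<delta> / 2<..<?s2 + \<delta> / 2}"
  show ?thesis
  proof (rule that[OF smooth L(1) supp])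
    show "open T"
      unfolding T_def by (rule continuous_open_preimage[OF cont_\<tau> open_I]) simp
    show "T \<subseteq> I" by (simp add: T_def)
    show "{t1..t2} \<subseteq> T"
    proof
      fix t assume t: "t \<in> {t1..t2}"
      then have "\<tau> t \<in> {?s1..?s2}" using image_\<tau>_interval[OF t12] by blast
      moreover have "t \<in> I" using t mem_is_interval_1_I[OF interval_I t12(1,2)] by auto
      ultimately show "t \<in> T" using \<delta>(1) by (auto simp: T_def)
    qed
    show "\<phi> (x, t) = \<psi> (dil (E t) x, \<tau> t)" if "t \<in> T" for x t
      using that \<eta>(3)[of "\<tau> t"] by (simp add: T_def \<psi>_def inv_chart_inverse)
  qed
qed

text \<open>Test the equation of \<open>u\<close> with the transported test function and substitute. With \<open>w = jac u\<close> and
  \<open>H i = jac E i G i\<close>, the Jacobian determinant \<open>jac\<close> and \<open>\<tau>'\<close> turn the integrals for \<open>u\<close> into those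
  for \<open>w\<close>, and the chain rule gives the fluxes: the old one is multiplied by \<open>jac \<tau>' / E i\<close>, and the
  motion of the dilation adds \<open>(E' i / E i) x i w\<close>. The hypothesis asks that the result
  be independent of time.\<close>

theorem local_weak_solution_pullback:
  assumes u: "local_weak_solution p A UNIV J u"
    and flux: "\<And>t i x v \<xi>. t \<in> I \<Longrightarrow> B i x (jac t * v) (jac t * E t i * \<xi>) =
      jac t * \<tau>' t / E t i * A i (dil (E t) x) v \<xi> + E' t i / E t i * x $ i * (jac t * v)"
  shows "local_weak_solution p B UNIV I (pullback jac u)"
proof -
  obtain G where C0: "C0_L2_loc J UNIV u" and W: "L1_loc_W11_loc J UNIV u G"
    and Lp: "\<And>i. Lq_loc_Lq_loc (p i) J UNIV (G i)"
    and weak: "\<And>s1 s2 K \<psi>. s1 \<in> J \<Longrightarrow> s2 \<in> J \<Longrightarrow> s1 < s2 \<Longrightarrow> compact K \<Longrightarrow> smooth_on (UNIV \<times> J) \<psi> \<Longrightarrow>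
      (\<forall>s\<in>J. \<forall>y\<in>UNIV - K. \<psi> (y, s) = 0) \<Longrightarrow>
      (LINT y:K|lebesgue. u (y, s2) * \<psi> (y, s2)) - (LINT y:K|lebesgue. u (y, s1) * \<psi> (y, s1)) +
      (LINT s:{s1..s2}|lebesgue. LINT y:K|lebesgue.
         - u (y, s) * frechet_derivative \<psi> (at (y, s)) (0, 1) +
         (\<Sum>i\<in>UNIV. A i y (u (y, s)) (G i (y, s)) * frechet_derivative \<psi> (at (y, s)) (axis i 1, 0))) = 0"
    using u unfolding local_weak_solution_def by auto
  define w where "w = pullback jac u"
  define H where "H = (\<lambda>i. pullback (\<lambda>t. jac t * E t i) (G i))"
  have main: "(LINT x:K|lebesgue. w (x, t2) * \<phi> (x, t2)) - (LINT x:K|lebesgue. w (x, t1) * \<phi> (x, t1)) +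
      (LINT t:{t1..t2}|lebesgue. LINT x:K|lebesgue.
         - w (x, t) * frechet_derivative \<phi> (at (x, t)) (0, 1) +
         (\<Sum>i\<in>UNIV. B i x (w (x, t)) (H i (x, t)) * frechet_derivative \<phi> (at (x, t)) (axis i 1, 0))) = 0"
    if t12: "t1 \<in> I" "t2 \<in> I" "t1 < t2" and K: "compact K" and \<phi>: "smooth_on (UNIV \<times> I) \<phi>"
      "\<forall>t\<in>I. \<forall>x\<in>UNIV - K. \<phi> (x, t) = 0" for t1 t2 K \<phi>
  proof -
    have supp\<phi>: "\<phi> (x, t) = 0" if "t \<in> I" "x \<notin> K" for x t
      using \<phi>(2) that by blast
    from transported_test_function[OF t12 K \<phi>(1) supp\<phi>]
    obtain \<psi> L T where \<psi>: "smooth_on (UNIV \<times> J) \<psi>" and L: "compact L"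
      and supp\<psi>: "\<And>s y. s \<in> J \<Longrightarrow> y \<notin> L \<Longrightarrow> \<psi> (y, s) = 0"
      and T: "open T" "T \<subseteq> I" "{t1..t2} \<subseteq> T"
      and \<phi>\<psi>: "\<And>x t. t \<in> T \<Longrightarrow> \<phi> (x, t) = \<psi> (dil (E t) x, \<tau> t)"
      by blast
    define D where "D = (\<lambda>y s. frechet_derivative \<psi> (at (y, s)))"
    define Q where "Q = (\<lambda>y s. - u (y, s) * D y s (0, 1) +
      (\<Sum>i\<in>UNIV. A i y (u (y, s)) (G i (y, s)) * D y s (axis i 1, 0)))"
    define P where "P = (\<lambda>x t. - w (x, t) * frechet_derivative \<phi> (at (x, t)) (0, 1) +
      (\<Sum>i\<in>UNIV. B i x (w (x, t)) (H i (x, t)) * frechet_derivative \<phi> (at (x, t)) (axis i 1, 0)))"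
    have D0: "D y s v = 0" if "s \<in> J" "y \<notin> L" for y s v
      unfolding D_def
    proof (rule frechet_derivative_eq_0_on_open[where S="(- L) \<times> J"])
      show "open ((- L) \<times> J)" by (intro open_Times open_J open_Compl compact_imp_closed L)
    qed (use that supp\<psi> in auto)
    have Dphi0: "frechet_derivative \<phi> (at (x, t)) v = 0" if "t \<in> I" "x \<notin> K" for x t v
    proof (rule frechet_derivative_eq_0_on_open[where S="(- K) \<times> I"])
      show "open ((- K) \<times> I)" by (intro open_Times open_I open_Compl compact_imp_closed K)
    qed (use that supp\<phi> in auto)
    have PQ: "P x t = jac t * \<tau>' t * Q (dil (E t) x) (\<tau> t)" if t: "t \<in> {t1..t2}" for x t
    proof -
      have tT: "t \<in> T" and tI: "t \<in> I" using t T by auto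
      let ?d = "\<lambda>i. D (dil (E t) x) (\<tau> t) (axis i 1, 0)" and ?ds = "D (dil (E t) x) (\<tau> t) (0, 1)"
      let ?v = "u (dil (E t) x, \<tau> t)" and ?\<xi> = "\<lambda>i. G i (dil (E t) x, \<tau> t)"
      note der = frechet_derivative_chart[OF tT T(1,2) \<phi>\<psi> \<psi>, of x, folded D_def]
      have summand: "B i x (jac t * ?v) (jac t * E t i * ?\<xi> i) * (E t i * ?d i) =
          jac t * \<tau>' t * (A i (dil (E t) x) ?v (?\<xi> i) * ?d i) + jac t * ?v * (E' t i * x $ i * ?d i)" for i
        unfolding flux[OF tI] using E_pos[OF tI, of i] by (simp add: field_simps)
      have "P x t = - (jac t * ?v) * ((\<Sum>i\<in>UNIV. E' t i * x $ i * ?d i) + \<tau>' t * ?ds) +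
          (\<Sum>i\<in>UNIV. B i x (jac t * ?v) (jac t * E t i * ?\<xi> i) * (E t i * ?d i))"
        by (simp add: P_def w_def H_def der D_def)
      also have "\<dots> = jac t * \<tau>' t * Q (dil (E t) x) (\<tau> t)"
        unfolding summand sum.distrib sum_distrib_left[symmetric] Q_def by (simp add: algebra_simps)
      finally show ?thesis .
    qed
    have inner: "(LINT x:K|lebesgue. P x t) = \<tau>' t * (LINT y:L|lebesgue. Q y (\<tau> t))" if t: "t \<in> {t1..t2}" for t
    proof -
      have tI: "t \<in> I" using t T by auto
      have "(LINT x:K|lebesgue. P x t) = (LINT x|lebesgue. P x t)"
        by (rule set_integral_eq_integral) (simp add: P_def Dphi0[OF tI])
      also have "\<dots> = jac t * \<tau>' t * (LINT x|lebesgue. Q (dil (E t) x) (\<tau> t))"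
        by (simp add: PQ[OF t])
      also have "\<dots> = \<tau>' t * (LINT y|lebesgue. Q y (\<tau> t))"
        using jac_pos[OF tI]
        by (subst integral_dil[OF E_pos[OF tI], of "\<lambda>y. Q y (\<tau> t)"]) (simp del: prod_zero_iff)
      also have "(LINT y|lebesgue. Q y (\<tau> t)) = (LINT y:L|lebesgue. Q y (\<tau> t))"
        by (rule set_integral_eq_integral[symmetric]) (simp add: Q_def D0[OF \<tau>_in[OF tI]])
      finally show ?thesis .
    qed
    have boundary: "(LINT x:K|lebesgue. w (x, t) * \<phi> (x, t)) =
        (LINT y:L|lebesgue. u (y, \<tau> t) * \<psi> (y, \<tau> t))" if t: "t \<in> {t1..t2}" for t
    proof -
      have tT: "t \<in> T" and tI: "t \<in> I" using t T by auto
      have "(LINT x:K|lebesgue. w (x, t) * \<phi> (x, t)) = (LINT x|lebesgue. w (x, t) * \<phi> (x, t))"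
        by (rule set_integral_eq_integral) (simp add: supp\<phi>[OF tI])
      also have "\<dots> = jac t * (LINT x|lebesgue. u (dil (E t) x, \<tau> t) * \<psi> (dil (E t) x, \<tau> t))"
        by (simp add: w_def \<phi>\<psi>[OF tT] mult.assoc)
      also have "\<dots> = (LINT y|lebesgue. u (y, \<tau> t) * \<psi> (y, \<tau> t))"
        using jac_pos[OF tI]
        by (subst integral_dil[OF E_pos[OF tI], of "\<lambda>y. u (y, \<tau> t) * \<psi> (y, \<tau> t)"]) (simp del: prod_zero_iff)
      also have "\<dots> = (LINT y:L|lebesgue. u (y, \<tau> t) * \<psi> (y, \<tau> t))"
        by (rule set_integral_eq_integral[symmetric]) (simp add: supp\<psi>[OF \<tau>_in[OF tI]])
      finally show ?thesis .
    qed
    have sub: "{t1..t2} \<subseteq> I" using T by auto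
    have "(LINT t:{t1..t2}|lebesgue. LINT x:K|lebesgue. P x t) =
        (LINT t:{t1..t2}|lebesgue. \<tau>' t * (LINT y:L|lebesgue. Q y (\<tau> t)))"
      by (rule set_lebesgue_integral_cong) (auto simp: inner)
    also have "\<dots> = (LINT s:{\<tau> t1..\<tau> t2}|lebesgue. LINT y:L|lebesgue. Q y s)"
      using integral_\<tau>(2)[OF sub, of "\<lambda>s. LINT y:L|lebesgue. Q y s"]
      by (simp add: image_\<tau>_interval[OF t12])
    finally have "(LINT x:K|lebesgue. w (x, t2) * \<phi> (x, t2)) - (LINT x:K|lebesgue. w (x, t1) * \<phi> (x, t1)) +
        (LINT t:{t1..t2}|lebesgue. LINT x:K|lebesgue. P x t) =
        (LINT y:L|lebesgue. u (y, \<tau> t2) * \<psi> (y, \<tau> t2)) - (LINT y:L|lebesgue. u (y, \<tau> t1) * \<psi> (y, \<tau> t1)) +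
        (LINT s:{\<tau> t1..\<tau> t2}|lebesgue. LINT y:L|lebesgue. Q y s)"
      using t12(3) by (simp add: boundary)
    also have "\<dots> = 0"
      unfolding Q_def D_def
      by (rule weak[OF \<tau>_in[OF t12(1)] \<tau>_in[OF t12(2)] \<tau>_strict_mono[OF t12] L \<psi>]) (use supp\<psi> in blast)
    finally show ?thesis unfolding P_def .
  qed
  have "C0_L2_loc I UNIV w" "L1_loc_W11_loc I UNIV w H"
    unfolding w_def H_def by (rule C0_L2_loc_pullback[OF C0], rule L1_loc_W11_loc_pullback[OF W])
  moreover have "Lq_loc_Lq_loc (p i) I UNIV (H i)" for i
    unfolding H_def
    by (intro Lq_loc_Lq_loc_pullback Lp continuous_on_mult cont_jac cont_E mult_pos_pos jac_pos E_pos)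
  ultimately show ?thesis
    unfolding local_weak_solution_def w_def[symmetric]
    using open_I interval_I main by auto
qed

end

section \<open>Exponents\<close>

lemma pbar_gt_2:
  fixes p :: "'n::finite \<Rightarrow> real"
  assumes p: "\<And>i. 2 < p i"
  shows "2 < pbar p"
proof -
  let ?S = "\<Sum>i\<in>UNIV. 1 / p i"
  have "0 < 1 / p i" "1 / p i < 1 / 2" for i
    using p[of i] by (auto simp: field_simps)
  then have S: "0 < ?S" "?S < (\<Sum>i\<in>(UNIV :: 'n set). 1 / 2)"
    by (auto intro!: sum_pos sum_strict_mono simp del: sum_constant)
  then have "2 * ?S < real CARD('n)" by simp
  then show ?thesis unfolding pbar_def using S(1) by (subst less_divide_eq) simp
qed

lemma lam_pos: "(\<And>i. 2 < p i) \<Longrightarrow> 0 < lam p"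
  using pbar_gt_2[of p] by (simp add: lam_def add_nonneg_pos)

text \<open>This makes the factor \<open>exp (\<alpha> t)\<close> in \<open>\<Phi>\<close> the Jacobian determinant of its dilation, so that \<open>\<Phi>\<close>
  preserves mass.\<close>

lemma sum_alpha_i:
  fixes p :: "'n::finite \<Rightarrow> real"
  assumes p: "\<And>i. 2 < p i"
  shows "(\<Sum>i\<in>UNIV. alpha_i p i) = alpha p"
proof -
  let ?N = "real CARD('n)"
  have p0: "p i \<noteq> 0" for i using p[of i] by simp
  have lam: "lam p \<noteq> 0" using lam_pos[of p] p by simp
  have eq: "alpha_i p i = ((?N * pbar p + pbar p) * (1 / p i) - ?N) / lam p" for i
    using p0[of i] lam by (simp add: alpha_i_def field_simps)
  have "pbar p * (\<Sum>i\<in>UNIV. 1 / p i) = ?N"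
    using pbar_gt_2[of p] p by (auto simp: pbar_def)
  then have "(?N * pbar p + pbar p) * (\<Sum>i\<in>UNIV. 1 / p i) = (?N + 1) * ?N"
    by (simp add: algebra_simps)
  then show ?thesis
    unfolding eq sum_divide_distrib[symmetric] sum_subtractf sum_distrib_left[symmetric]
    by (simp add: alpha_def algebra_simps)
qed

text \<open>With \<open>\<tau> t = exp t\<close> and \<open>E t i = exp (\<alpha>\<^sub>i t)\<close>, the left-hand side is the growth rate of
  \<open>(jac E i) powr (p i - 1)\<close>, the factor that a power flux acquires, and the right-hand side that of
  \<open>jac \<tau>' / E i\<close>, the factor created by the change of variables.\<close>

lemma alpha_balance:
  fixes p :: "'n::finite \<Rightarrow> real"
  assumes p: "\<And>i. 2 < p i"
  shows "(alpha p + alpha_i p i) * (p i - 1) = alpha p + 1 - alpha_i p i"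
proof -
  have "p i \<noteq> 0" using p[of i] by simp
  have lam: "lam p \<noteq> 0" using lam_pos[of p] p by simp
  have "(alpha p + alpha_i p i) * p i = 2 * alpha p + 1"
    unfolding alpha_def alpha_i_def using \<open>p i \<noteq> 0\<close> lam
    by (simp add: field_simps) (simp add: lam_def algebra_simps)
  then show ?thesis by (simp add: algebra_simps)
qed

lemma powr_flux:
  fixes \<kappa> \<xi> q :: real
  assumes "0 < \<kappa>"
  shows "\<bar>\<kappa> * \<xi>\<bar> powr (q - 2) * (\<kappa> * \<xi>) = \<kappa> powr (q - 1) * (\<bar>\<xi>\<bar> powr (q - 2) * \<xi>)"
proof -
  have "\<kappa> powr (q - 1) = \<kappa> powr (q - 2) * \<kappa>"
    using assms powr_add[of \<kappa> "q - 2" 1] by simp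
  then show ?thesis using assms by (simp add: abs_mult powr_mult)
qed

section \<open>Self-similar and stationary solutions\<close>

lemma coordinate_change_exp:
  fixes a :: "'n::finite \<Rightarrow> real"
  shows "coordinate_change UNIV {0<..} exp exp ln
    (\<lambda>t i. exp (a i * t)) (\<lambda>t i. a i * exp (a i * t))"
proof
  show "smooth_on {0<..} (\<lambda>s. 1 / exp (a i * ln s))" for i
    by (rule smooth_on_cong[OF _ _ smooth_on_powr[of "- a i"]])
       (auto simp: powr_def exp_minus field_simps)
  show "((\<lambda>t. exp (a i * t)) has_real_derivative a i * exp (a i * t)) (at t)" for t i
    by (auto intro!: derivative_eq_intros)
qed (auto intro: smooth_on_ln DERIV_exp continuous_intros is_interval_univ is_interval_oi)

lemma coordinate_change_ln:
  fixes a :: "'n::finite \<Rightarrow> real"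
  shows "coordinate_change {0<..} UNIV ln (\<lambda>s. 1 / s) exp
    (\<lambda>s i. s powr (- a i)) (\<lambda>s i. - a i * s powr (- a i - 1))"
proof
  show "smooth_on UNIV (\<lambda>t. 1 / (exp t) powr (- a i))" for i
    by (rule smooth_on_cong[OF _ _ smooth_on_exp[of "a i"]])
       (auto simp: powr_def exp_minus field_simps)
  show "smooth_on UNIV (exp :: real \<Rightarrow> real)"
    using smooth_on_exp[of 1] by simp
  show "((\<lambda>s. s powr (- a i)) has_real_derivative - a i * s powr (- a i - 1)) (at s)"
    if "s \<in> {0<..}" for s i
    using that by (intro has_real_derivative_powr) simp
  show "(ln has_real_derivative 1 / s) (at s)" if "s \<in> {0<..}" for s :: real
    using that by (intro DERIV_ln_divide) simp
  show "continuous_on {0<..} (\<lambda>s::real. 1 / s)"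
    by (intro continuous_intros) auto
qed (auto intro: is_interval_univ is_interval_oi)

theorem solution_FP_Phi:
  fixes p :: "'n::finite \<Rightarrow> real"
  assumes p: "\<And>i. 2 < p i" and u: "solution_A p u"
  shows "solution_FP p (Phi p u)"
proof -
  interpret coordinate_change UNIV "{0<..}" exp exp ln
    "\<lambda>t i. exp (alpha_i p i * t)" "\<lambda>t i. alpha_i p i * exp (alpha_i p i * t)"
    by (rule coordinate_change_exp)
  have jac: "jac t = exp (alpha p * t)" for t
    by (simp add: exp_sum[symmetric] sum_distrib_right[symmetric] sum_alpha_i[OF p])
  have "local_weak_solution p (flux_FP p) UNIV UNIV (pullback jac u)"
  proof (rule local_weak_solution_pullback[OF u[unfolded solution_A_def]])
    fix t i and x :: "real ^ 'n" and v \<xi> :: real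
    have "jac t * exp (alpha_i p i * t) = exp ((alpha p + alpha_i p i) * t)"
      unfolding jac exp_add[symmetric] by (simp add: algebra_simps)
    moreover have "exp ((alpha p + alpha_i p i) * t) powr (p i - 1) =
        exp ((alpha p + 1 - alpha_i p i) * t)"
      unfolding alpha_balance[of p i, OF p, symmetric] by (simp add: powr_def algebra_simps)
    moreover have "exp ((alpha p + 1 - alpha_i p i) * t) =
        exp (alpha p * t) * exp t / exp (alpha_i p i * t)"
      by (simp add: exp_add[symmetric] exp_diff[symmetric] algebra_simps)
    ultimately have "flux_A p i x v (jac t * exp (alpha_i p i * t) * \<xi>) =
        jac t * exp t / exp (alpha_i p i * t) * flux_A p i x v \<xi>"
      by (simp add: flux_A_def powr_flux jac)
    then show "flux_FP p i x (jac t * v) (jac t * exp (alpha_i p i * t) * \<xi>) =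
        jac t * exp t / exp (alpha_i p i * t) * flux_A p i (dil (\<lambda>i. exp (alpha_i p i * t)) x) v \<xi> +
        alpha_i p i * exp (alpha_i p i * t) / exp (alpha_i p i * t) * x $ i * (jac t * v)"
      by (simp add: flux_FP_def flux_A_def)
  qed
  moreover have "pullback jac u = Phi p u"
    by (simp add: pullback_def Phi_def jac dil_def)
  ultimately show ?thesis by (simp add: solution_FP_def)
qed

theorem solution_A_Phi_inv:
  fixes p :: "'n::finite \<Rightarrow> real"
  assumes p: "\<And>i. 2 < p i" and w: "solution_FP p w"
  shows "solution_A p (Phi_inv p w)"
proof -
  interpret coordinate_change "{0<..}" UNIV ln "\<lambda>s. 1 / s" exp
    "\<lambda>s i. s powr (- alpha_i p i)" "\<lambda>s i. - alpha_i p i * s powr (- alpha_i p i - 1)"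
    by (rule coordinate_change_ln)
  have jac: "jac s = s powr (- alpha p)" for s :: real
    by (cases "s = 0") (simp_all add: powr_sum[symmetric] sum_negf sum_alpha_i[OF p])
  have "local_weak_solution p (flux_A p) UNIV {0<..} (pullback jac w)"
  proof (rule local_weak_solution_pullback[OF w[unfolded solution_FP_def]])
    fix s :: real and i and x :: "real ^ 'n" and v \<xi> :: real
    assume "s \<in> {0<..}"
    then have s: "0 < s" by simp
    have "jac s * s powr (- alpha_i p i) = s powr (- (alpha p + alpha_i p i))"
      by (simp add: jac powr_add[symmetric])
    moreover have "(s powr (- (alpha p + alpha_i p i))) powr (p i - 1) =
        s powr (- (alpha p + 1 - alpha_i p i))"
      unfolding alpha_balance[of p i, OF p, symmetric] powr_powr by (simp add: algebra_simps)
    moreover have "s powr (- (alpha p + 1 - alpha_i p i)) =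
        s powr (- alpha p) * (1 / s) / s powr (- alpha_i p i)"
    proof -
      have "s powr (- (alpha p + 1 - alpha_i p i)) = s powr (- alpha p - 1 - - alpha_i p i)"
        by (rule arg_cong[where f="(powr) s"]) simp
      also have "\<dots> = s powr (- alpha p - 1) / s powr (- alpha_i p i)"
        by (rule powr_diff)
      also have "s powr (- alpha p - 1) = s powr (- alpha p) * (1 / s)"
        using s powr_diff[of s "- alpha p" 1] by simp
      finally show ?thesis .
    qed
    ultimately have A: "flux_A p i x (jac s * v) (jac s * s powr (- alpha_i p i) * \<xi>) =
        jac s * (1 / s) / s powr (- alpha_i p i) * flux_A p i x v \<xi>"
      using s by (simp add: flux_A_def powr_flux jac)
    \<comment> \<open>The drift of the Fokker-Planck flux cancels against the one created by the dilation.\<close>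
    have drift: "jac s * (1 / s) / s powr (- alpha_i p i) * (alpha_i p i * (s powr (- alpha_i p i) * x $ i) * v) +
        - alpha_i p i * s powr (- alpha_i p i - 1) / s powr (- alpha_i p i) * x $ i * (jac s * v) = 0"
      using s by (simp add: powr_diff field_simps)
    show "flux_A p i x (jac s * v) (jac s * s powr (- alpha_i p i) * \<xi>) =
        jac s * (1 / s) / s powr (- alpha_i p i) * flux_FP p i (dil (\<lambda>i. s powr (- alpha_i p i)) x) v \<xi> +
        - alpha_i p i * s powr (- alpha_i p i - 1) / s powr (- alpha_i p i) * x $ i * (jac s * v)"
      unfolding A flux_FP_def distrib_left add.assoc dil_nth drift by (simp add: flux_A_def)
  qed
  moreover have "pullback jac w = Phi_inv p w"
    by (simp add: pullback_def Phi_inv_def jac dil_def)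
  ultimately show ?thesis by (simp add: solution_A_def)
qed

text \<open>Self-similarity with \<open>\<rho> = exp (t / pbar p)\<close>, read at time 1, says that the slice of
  \<open>Phi p u\<close> at time \<open>t\<close> is \<open>u (x, 1)\<close>.\<close>

lemma Phi_eq_scaling:
  fixes p :: "'n::finite \<Rightarrow> real"
  assumes "pbar p \<noteq> 0"
  shows "Phi p u (x, t) = scaling p (exp (t / pbar p)) u (x, 1)"
  using assms by (simp add: Phi_def scaling_def powr_def)

lemma scaling_Phi_inv:
  fixes p :: "'n::finite \<Rightarrow> real"
  assumes "0 < \<rho>" "0 < t"
  shows "scaling p \<rho> (Phi_inv p w) (x, t) =
    t powr (- alpha p) * w (dil (\<lambda>i. t powr (- alpha_i p i)) x, ln (\<rho> powr pbar p * t))"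
proof -
  have eq: "(\<rho> powr pbar p * t) powr (- a) * (\<rho> powr (a * pbar p) * r) = t powr (- a) * r" for a r
    using assms by (simp add: powr_mult powr_powr powr_minus field_simps)
  have eq': "\<rho> powr (a * pbar p) * ((\<rho> powr pbar p * t) powr (- a) * r) = t powr (- a) * r" for a r
    using eq[of a r] by (simp add: algebra_simps)
  show ?thesis
    by (simp add: scaling_def Phi_inv_def dil_def eq eq')
qed

theorem proposition2p3:
  fixes p :: "'n::{finite,linorder} \<Rightarrow> real"
  assumes "CARD('n) > 1"
    and "pbar p < real CARD('n)"
    and "mono p"
    and "\<forall>i. 2 < p i"
    and "\<forall>i. p i < pbar_star p"
  shows "(\<forall>u. self_similar_solution_A p u \<longrightarrow> stationary_solution_FP p (Phi p u)) \<and>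
         (\<forall>w. stationary_solution_FP p w \<longrightarrow> self_similar_solution_A p (Phi_inv p w))"
proof (intro conjI allI impI)
  have p: "2 < p i" for i using assms(4) by blast
  have pbar: "pbar p \<noteq> 0" using pbar_gt_2[of p] p by simp
  fix u assume u: "self_similar_solution_A p u"
  have slice: "AE x in lebesgue. Phi p u (x, t) = u (x, 1)" for t
    using u unfolding self_similar_solution_A_def Phi_eq_scaling[OF pbar] by simp
  have "AE x in lebesgue. Phi p u (x, s) = Phi p u (x, t)" for s t
    using slice[of s] slice[of t] by eventually_elim simp
  then show "stationary_solution_FP p (Phi p u)"
    using u solution_FP_Phi[of p u, OF p] by (simp add: stationary_solution_FP_def self_similar_solution_A_def)
next
  have p: "2 < p i" for i using assms(4) by blast
  fix w assume w: "stationary_solution_FP p w"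
  have "AE x in lebesgue. scaling p \<rho> (Phi_inv p w) (x, t) = Phi_inv p w (x, t)" if "0 < \<rho>" "0 < t" for \<rho> t
  proof -
    have "AE x in lebesgue. w (x, ln (\<rho> powr pbar p * t)) = w (x, ln t)"
      using w by (simp add: stationary_solution_FP_def)
    then have "AE x in lebesgue. w (dil (\<lambda>i. t powr (- alpha_i p i)) x, ln (\<rho> powr pbar p * t)) =
        w (dil (\<lambda>i. t powr (- alpha_i p i)) x, ln t)"
      by (rule AE_dil[rotated]) (use that in simp)
    then show ?thesis
      by eventually_elim (use that in \<open>simp add: scaling_Phi_inv\<close>, simp add: Phi_inv_def dil_def)
  qed
  then show "self_similar_solution_A p (Phi_inv p w)"
    using w solution_A_Phi_inv[of p w, OF p] by (simp add: stationary_solution_FP_def self_similar_solution_A_def)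
qed

end
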